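(* Let $f:\mathbb{R}^n\to\mathbb{R}\cup\{+\infty\}$ and $g:\mathbb{R}^m\to\mathbb{R}\cup\{+\infty\}$ be closed proper convex functions and let $M$ be an $m\times n$ real matrix. Consider the primal problem $\min_{x\in\mathbb{R}^n}\{f(x)+g(Mx)\}$ and the dual problem $\min_{p\in\mathbb{R}^m}\{f^*(-M^\top p)+g^*(p)\}$. Let $W$ be a symmetric positive definite $m\times m$ matrix, let $\{\tau_k^x\}_{k=0}^\infty,\{\tau_k^z\}_{k=0}^\infty$ be sequences of nonnegative reals with $$\sum_{k=0}^\infty\sqrt{\tau_k^x}<\infty,\qquad \sum_{k=0}^\infty\sqrt{\tau_k^z}<\infty,$$ and let $\{\nu_k\}_{k=0}^\infty\subset\mathbb{R}$ satisfy $\inf_k\nu_k>0$ and $\sup_k\nu_k<2$. For a constant scalar $c>0$ and arbitrary initial $z^0,p^0\in\mathbb{R}^m$, suppose that the sequences $\{z^k\}_{k=0}^\infty,\{p^k\}_{k=0}^\infty\subset\mathbb{R}^m$ and $\{x^k\}_{k=1}^\infty\subset\mathbb{R}^n$ satisfy the following for all $k\ge0$: $$x^{k+1}\in\tau_k^x\text{-}\!\operatorname*{arg\,min}_{x\in\mathbb{R}^n}\Big\{f(x)+\langle p^k,Mx\rangle+\frac c2\|Mx-z^k\|_W^2\Big\},$$ $$z^{k+1}\in\tau_k^z\text{-}\!\operatorname*{arg\,min}_{z\in\mathbb{R}^m}\Big\{g(z)-\langle p^k,z\rangle+\frac c2\|\nu_kMx^{k+1}+(1-\nu_k)z^k-z\|_W^2\Big\},$$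 $$p^{k+1}=p^k+cW\big(\nu_kMx^{k+1}+(1-\nu_k)z^k-z^{k+1}\big),$$ where the exact minimum in each of the minimizations is assumed to be attained for every $k$. If strong duality holds for $f$, $g$, and $M$, then $\{p^k\}$ converges to a solution $p^*$ of the dual problem, while $\{z^k\}$ and $\{Mx^k\}$ converge to some $z^*\in\mathbb{R}^m$ such that $z^*\in\partial g^*(p^* )$ and $-z^*\in\partial\big(f^*\circ(-M^\top)\big)(p^* )$. If the regularity condition $\operatorname{ri}\operatorname{im}\partial f\cap\operatorname{im}M^\top\neq\emptyset$ is also true, then $z^*=Mx^*$, where $x^*$ is some solution of the primal problem, and all limit points of $\{x^k\}$ are optimal primal solutions. If the dual problem has no solution but there exists some $\bar p\in\mathbb{R}^m$ at which the dual objective $f^*(-M^\top p)+g^*(p)$ is finite, then at least one of the sequences $\{p^k\}$ or $\{z^k\}$ must be unbounded.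
   Context: $\|u\|_W=\sqrt{u^\top Wu}$; $f^*,g^*$ are convex conjugates; $f^*\circ(-M^\top)$ is the function $p\mapsto f^*(-M^\top p)$; $\partial$ is the convex subdifferential; $\operatorname{im}\partial f=\bigcup_{x}\partial f(x)$; $\operatorname{im}M^\top$ is the range of $M^\top$; $\operatorname{ri}$ is the relative interior. For $\delta\ge0$, a set $S$ and $h:S\to\mathbb{R}\cup\{\pm\infty\}$, $\ \delta\text{-}\!\operatorname*{arg\,min}_{x\in S}\{h(x)\}=\{x\in S\mid h(x)\le(\inf_{y\in S}h(y))+\delta\}$. "Strong duality holds for $f$, $g$, $M$" means that there exist $x^*\in\mathbb{R}^n$ and $p^*\in\mathbb{R}^m$ such that $\big(f(x^* )+g(Mx^* )\big)+\big(f^*(-M^\top p^* )+g^*(p^* )\big)=0$; equivalently $-M^\top p^*\in\partial f(x^* )$ and $p^*\in\partial g(Mx^* )$. *)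

theory Defs
  imports "HOL-Analysis.Analysis"
begin

text \<open>
  Functions with values in \<open>\<real> \<union> {+\<infinity>}\<close> are modelled as functions into \<^typ>\<open>ereal\<close>, the value
  \<open>-\<infinity>\<close> being excluded by properness. This matters for sums, because \<open>\<infinity> + (-\<infinity>) = \<infinity>\<close> in
  \<^typ>\<open>ereal\<close>.
\<close>

text \<open>The library's \<open>epigraph\<close> covers only real-valued functions.\<close>

definition ereal_epigraph :: "('a \<Rightarrow> ereal) \<Rightarrow> ('a \<times> real) set"
  where "ereal_epigraph f = {(x, r). f x \<le> ereal r}"

definition proper :: "('a \<Rightarrow> ereal) \<Rightarrow> bool"
  where "proper f \<longleftrightarrow> (\<forall>x. f x \<noteq> - \<infinity>) \<and> (\<exists>x. f x \<noteq> \<infinity>)"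

definition closed_proper_convex :: "('a::euclidean_space \<Rightarrow> ereal) \<Rightarrow> bool"
  where "closed_proper_convex f \<longleftrightarrow>
    closed (ereal_epigraph f) \<and> proper f \<and> convex (ereal_epigraph f)"

definition conjugate :: "('a::euclidean_space \<Rightarrow> ereal) \<Rightarrow> 'a \<Rightarrow> ereal"
  where "conjugate f p = (SUP x. ereal (p \<bullet> x) - f x)"

definition subdifferential :: "('a::euclidean_space \<Rightarrow> ereal) \<Rightarrow> 'a \<Rightarrow> 'a set"
  where "subdifferential f x = {v. \<forall>y. f y \<ge> f x + ereal (v \<bullet> (y - x))}"

definition approx_argmin :: "real \<Rightarrow> 'a set \<Rightarrow> ('a \<Rightarrow> ereal) \<Rightarrow> 'a set"
  where "approx_argmin \<delta> S h = {x \<in> S. h x \<le> (INF y\<in>S. h y) + ereal \<delta>}"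

abbreviation minimizer :: "('a \<Rightarrow> ereal) \<Rightarrow> 'a \<Rightarrow> bool"
  where "minimizer h x \<equiv> is_arg_min h (\<lambda>_. True) x"

definition limit_point :: "(nat \<Rightarrow> 'a::topological_space) \<Rightarrow> 'a \<Rightarrow> bool"
  where "limit_point X l \<longleftrightarrow> (\<exists>r. strict_mono r \<and> (X \<circ> r) \<longlonglongrightarrow> l)"

definition symmetric_positive_definite :: "real^'m^'m \<Rightarrow> bool"
  where "symmetric_positive_definite W \<longleftrightarrow>
    transpose W = W \<and> (\<forall>v. v \<noteq> 0 \<longrightarrow> v \<bullet> (W *v v) > 0)"

definition norm_W :: "real^'m^'m \<Rightarrow> real^'m \<Rightarrow> real"
  where "norm_W W u = sqrt (u \<bullet> (W *v u))"

definition primal_obj ::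
    "(real^'n \<Rightarrow> ereal) \<Rightarrow> (real^'m \<Rightarrow> ereal) \<Rightarrow> real^'n^'m \<Rightarrow> real^'n \<Rightarrow> ereal"
  where "primal_obj f g M x = f x + g (M *v x)"

definition dual_obj ::
    "(real^'n \<Rightarrow> ereal) \<Rightarrow> (real^'m \<Rightarrow> ereal) \<Rightarrow> real^'n^'m \<Rightarrow> real^'m \<Rightarrow> ereal"
  where "dual_obj f g M p = conjugate f (- (transpose M *v p)) + conjugate g p"

definition strong_duality ::
    "(real^'n \<Rightarrow> ereal) \<Rightarrow> (real^'m \<Rightarrow> ereal) \<Rightarrow> real^'n^'m \<Rightarrow> bool"
  where "strong_duality f g M \<longleftrightarrow> (\<exists>x p. primal_obj f g M x + dual_obj f g M p = 0)"

definition x_obj ::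
    "(real^'n \<Rightarrow> ereal) \<Rightarrow> real^'n^'m \<Rightarrow> real^'m^'m \<Rightarrow> real \<Rightarrow> real^'m \<Rightarrow> real^'m \<Rightarrow> real^'n \<Rightarrow> ereal"
  where "x_obj f M W c p z x =
    f x + ereal (p \<bullet> (M *v x)) + ereal (c / 2 * (norm_W W (M *v x - z))\<^sup>2)"

text \<open>In the iteration, the argument \<open>w\<close> is the relaxed point \<open>\<nu>\<^sub>k M x\<^sup>k\<^sup>+\<^sup>1 + (1 - \<nu>\<^sub>k) z\<^sup>k\<close>.\<close>

definition z_obj ::
    "(real^'m \<Rightarrow> ereal) \<Rightarrow> real^'m^'m \<Rightarrow> real \<Rightarrow> real^'m \<Rightarrow> real^'m \<Rightarrow> real^'m \<Rightarrow> ereal"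
  where "z_obj g W c p w z =
    g z - ereal (p \<bullet> z) + ereal (c / 2 * (norm_W W (w - z))\<^sup>2)"

end

theory Submission
  imports Defs
begin

text \<open>
  With \<open>p\<^sup>k = c W \<pi>\<^sup>k\<close>, one iteration is an inexact relaxed Douglas--Rachford step for
  \<open>u\<^sup>k = z\<^sup>k + \<pi>\<^sup>k\<close> in the inner product of \<open>W\<close>. Monotonicity of the subdifferentials gives
  \<open>\<parallel>u\<^sup>k\<^sup>+\<^sup>1 - u\<parallel> \<le> \<parallel>u\<^sup>k - u\<parallel>\<close> up to summable errors for every solution \<open>u = z + \<pi>\<close>, and
  \<open>M x\<^sup>k\<^sup>+\<^sup>1 - z\<^sup>k \<rightarrow> 0\<close>. Cluster points are again solutions, so the whole sequence converges. Under the
  regularity condition \<open>f\<close> is, up to a linear term that factors through \<open>M\<close>, coercive on a subspace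
  and invariant along its orthogonal complement, so the limit of \<open>M x\<^sup>k\<close> is attained. If the dual
  solution set is empty and the iterates were bounded, the cluster points of the \<open>\<nu>\<close>-weighted averages
  of the dual iterates would be dual solutions.
\<close>

section \<open>Minimization of convex functions with quadratic terms\<close>

text \<open>Subgradients of the conjugate of \<open>f\<close> composed with
  \<open>- transpose M\<close> need not come from subgradients of that conjugate itself, and
  \<open>x\<close> may be unbounded. So all estimates go through \<open>M *v x\<close>, and
  optimality of the \<open>f\<close>-part is expressed by values of the conjugate on the range of
  \<open>transpose M\<close>, not by a limit of \<open>x\<close>. The quadratic term bounds
  \<open>c / 2\<close> times the squared distance to an exact minimizer (in the image of
  \<open>M\<close> for the \<open>x\<close>-step) by the tolerance; this is the origin of the square
  roots in the summability assumptions. An error in the \<open>z\<close>-step is absorbed by the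
  multiplier update: it leaves the recursion for the sum of \<open>z\<close> and the scaled
  multiplier untouched and only perturbs how that sum splits into a point and a subgradient of
  \<open>g\<close>. Such a splitting exists only after one \<open>z\<close>-step, so the analysis
  starts after the first iteration.\<close>

declare transpose_matrix_vector [simp del]

text \<open>Lower semicontinuity in the form needed for extended values: the upper bounds converge,
  while the values \<open>h (X k)\<close> need not.\<close>

lemma closed_epigraph_limit:
  assumes "closed (ereal_epigraph h)" "X \<longlonglongrightarrow> l" "\<beta> \<longlonglongrightarrow> b"
    and "eventually (\<lambda>k. h (X k) \<le> ereal (\<beta> k)) sequentially"
  shows "h l \<le> ereal b"
proof -
  have "((\<lambda>k. (X k, \<beta> k)) \<longlongrightarrow> (l, b)) sequentially"
    using assms by (intro tendsto_Pair)
  moreover have "eventually (\<lambda>k. (X k, \<beta> k) \<in> ereal_epigraph h) sequentially"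
    using assms(4) by (simp add: ereal_epigraph_def)
  ultimately have "(l, b) \<in> ereal_epigraph h"
    using Lim_in_closed_set[OF assms(1)] by (metis trivial_limit_sequentially)
  then show ?thesis by (simp add: ereal_epigraph_def)
qed

lemma convex_epigraph_segment:
  assumes "convex (ereal_epigraph h)" "h x \<le> ereal a" "h y \<le> ereal b" "0 \<le> t" "t \<le> 1"
  shows "h ((1 - t) *\<^sub>R x + t *\<^sub>R y) \<le> ereal ((1 - t) * a + t * b)"
proof -
  have "(1 - t) *\<^sub>R (x, a) + t *\<^sub>R (y, b) \<in> ereal_epigraph h"
    by (rule convexD[OF assms(1)]) (use assms in \<open>auto simp: ereal_epigraph_def\<close>)
  then show ?thesis by (simp add: ereal_epigraph_def)
qed

text \<open>First-order optimality with \<open>D\<close> in the role of the derivative of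
  \<open>Q\<close> at \<open>x\<close> towards \<open>y\<close>. A move by \<open>t\<close> changes
  the objective by at most \<open>t * (b + D - a) + t\<^sup>2 * K\<close>, which would be negative
  for small \<open>t\<close> if the claim failed. Real upper bounds keep infinite values out of the
  arithmetic.\<close>

lemma minimizer_convex_plus:
  fixes h :: "'a::real_vector \<Rightarrow> ereal" and Q :: "'a \<Rightarrow> real"
  assumes "convex (ereal_epigraph h)" "h x \<le> ereal a" "h y \<le> ereal b"
    and min: "\<And>w r. h w \<le> ereal r \<Longrightarrow> a + Q x \<le> r + Q w"
    and Q: "\<And>t. 0 < t \<Longrightarrow> t < 1 \<Longrightarrow> Q ((1 - t) *\<^sub>R x + t *\<^sub>R y) \<le> Q x + t * D + t\<^sup>2 * K"
  shows "a \<le> b + D"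
proof (rule ccontr)
  assume "\<not> a \<le> b + D"
  define d where "d = a - b - D"
  have d: "d > 0" using \<open>\<not> a \<le> b + D\<close> by (simp add: d_def)
  \<comment> \<open>Small enough for the linear gain \<open>t * d\<close> to beat the remainder
    \<open>t\<^sup>2 * K\<close>; the \<open>+ 1\<close> below covers \<open>K = 0\<close>.\<close>
  define t where "t = min (1/2) (d / (2 * (\<bar>K\<bar> + 1)))"
  have t: "0 < t" "t < 1" using d by (auto simp: t_def)
  have "t * (2 * (\<bar>K\<bar> + 1)) \<le> d"
    using d by (auto simp: t_def min_def pos_le_divide_eq)
  then have "2 * (t * \<bar>K\<bar>) + 2 * t \<le> d" by (simp add: algebra_simps)
  moreover have "t * K \<le> t * \<bar>K\<bar>" using t by (intro mult_left_mono) auto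
  ultimately have "t * K < d" using t d by linarith
  have "a + Q x \<le> ((1 - t) * a + t * b) + Q ((1 - t) *\<^sub>R x + t *\<^sub>R y)"
    using convex_epigraph_segment[OF assms(1-3), of t] t by (intro min) auto
  with Q[OF t] have "0 \<le> t * (t * K - d)"
    by (simp add: d_def algebra_simps power2_eq_square)
  with t \<open>t * K < d\<close> show False
    by (simp add: zero_le_mult_iff)
qed

section \<open>Inner product and norm induced by a positive definite matrix\<close>

definition inner_W :: "real^'m^'m \<Rightarrow> real^'m \<Rightarrow> real^'m \<Rightarrow> real"
  where "inner_W W a b = a \<bullet> (W *v b)"

lemma inner_W_linear:
  "inner_W W (a + b) d = inner_W W a d + inner_W W b d"
  "inner_W W a (b + d) = inner_W W a b + inner_W W a d"
  "inner_W W (a - b) d = inner_W W a d - inner_W W b d"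
  "inner_W W a (b - d) = inner_W W a b - inner_W W a d"
  "inner_W W (t *\<^sub>R a) d = t * inner_W W a d"
  "inner_W W a (t *\<^sub>R d) = t * inner_W W a d"
  "inner_W W (- a) d = - inner_W W a d"
  "inner_W W a (- d) = - inner_W W a d"
  by (simp_all add: inner_W_def matrix_vector_right_distrib matrix_vector_mult_diff_distrib
      inner_simps matrix_vector_mult_scaleR
      vec.neg)

context
  fixes W :: "real^'m^'m"
  assumes W: "symmetric_positive_definite W"
begin

lemma inner_W_commute: "inner_W W a b = inner_W W b a"
  using W by (metis symmetric_positive_definite_def inner_W_def dot_lmul_matrix
      inner_commute transpose_matrix_vector)

lemma inner_W_pos: "a \<noteq> 0 \<Longrightarrow> inner_W W a a > 0"
  using W by (auto simp: symmetric_positive_definite_def inner_W_def)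

lemma inner_W_nonneg: "inner_W W a a \<ge> 0"
  using inner_W_pos[of a] by (cases "a = 0") (auto simp: inner_W_def)

lemma norm_W_square: "(norm_W W a)\<^sup>2 = inner_W W a a"
  using inner_W_nonneg[of a] by (simp add: norm_W_def inner_W_def)

lemma norm_W_nonneg [simp]: "norm_W W a \<ge> 0"
  using inner_W_nonneg[of a] by (simp add: norm_W_def inner_W_def)

lemma norm_W_scaleR: "norm_W W (t *\<^sub>R a) = \<bar>t\<bar> * norm_W W a"
proof (rule power2_eq_imp_eq)
  show "(norm_W W (t *\<^sub>R a))\<^sup>2 = (\<bar>t\<bar> * norm_W W a)\<^sup>2"
    unfolding power_mult_distrib norm_W_square by (simp add: inner_W_linear power2_eq_square)
qed auto

lemma norm_W_minus: "norm_W W (- a) = norm_W W a"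
  using norm_W_scaleR[of "-1" a] by simp

lemma norm_W_minus_commute: "norm_W W (a - b) = norm_W W (b - a)"
  using norm_W_minus[of "a - b"] by simp

lemma inner_W_le_norm_W: "inner_W W a b \<le> norm_W W a * norm_W W b"
proof (cases "b = 0")
  case True
  then show ?thesis by (simp add: inner_W_def)
next
  case False
  let ?t = "inner_W W a b / inner_W W b b"
  have b: "inner_W W b b > 0" using inner_W_pos[OF False] .
  have "0 \<le> inner_W W (a - ?t *\<^sub>R b) (a - ?t *\<^sub>R b)" by (rule inner_W_nonneg)
  also have "\<dots> = inner_W W a a - (inner_W W a b)\<^sup>2 / inner_W W b b"
    using b by (simp add: inner_W_linear inner_W_commute[of b a] field_simps power2_eq_square)
  finally have "(inner_W W a b)\<^sup>2 \<le> inner_W W a a * inner_W W b b"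
    using b by (simp add: field_simps)
  then have "(inner_W W a b)\<^sup>2 \<le> (norm_W W a * norm_W W b)\<^sup>2"
    by (simp add: power_mult_distrib norm_W_square)
  then show ?thesis by (rule power2_le_imp_le) simp
qed

lemma abs_inner_W_le: "\<bar>inner_W W a b\<bar> \<le> norm_W W a * norm_W W b"
  using inner_W_le_norm_W[of a b] inner_W_le_norm_W[of "- a" b]
  by (simp add: norm_W_minus inner_W_linear)

lemma norm_W_triangle: "norm_W W (a + b) \<le> norm_W W a + norm_W W b"
proof (rule power2_le_imp_le)
  show "(norm_W W (a + b))\<^sup>2 \<le> (norm_W W a + norm_W W b)\<^sup>2"
    using inner_W_le_norm_W[of a b]
    by (simp add: norm_W_square inner_W_linear inner_W_commute[of b a] power2_sum)
qed simp

lemma norm_W_triangle_diff: "norm_W W (a - b) \<le> norm_W W a + norm_W W b"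
  using norm_W_triangle[of a "- b"] by (simp add: norm_W_minus)

lemma norm_W_equivalent:
  obtains m K where "0 < m" "0 < K" "\<And>a. m * norm a \<le> norm_W W a" "\<And>a. norm_W W a \<le> K * norm a"
proof -
  have cont: "continuous_on (sphere 0 1) (norm_W W)"
    unfolding norm_W_def
    by (intro continuous_intros linear_continuous_on matrix_vector_mul_bounded_linear)
  have ne: "sphere 0 1 \<noteq> ({} :: (real^'m) set)" by simp
  obtain s where s: "s \<in> sphere 0 1" "\<And>y. y \<in> sphere 0 1 \<Longrightarrow> norm_W W s \<le> norm_W W y"
    using continuous_attains_inf[OF compact_sphere ne cont] by auto
  obtain S where S: "S \<in> sphere 0 1" "\<And>y. y \<in> sphere 0 1 \<Longrightarrow> norm_W W y \<le> norm_W W S"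
    using continuous_attains_sup[OF compact_sphere ne cont] by auto
  have pos: "norm_W W y > 0" if "y \<noteq> 0" for y
    using inner_W_pos[OF that] by (simp add: norm_W_def inner_W_def)
  have scale: "norm_W W a = norm a * norm_W W ((1 / norm a) *\<^sub>R a)" if "a \<noteq> 0" for a
    using that by (simp add: norm_W_scaleR)
  have "norm_W W s * norm a \<le> norm_W W a \<and> norm_W W a \<le> norm_W W S * norm a" for a
  proof (cases "a = 0")
    case False
    have "(1 / norm a) *\<^sub>R a \<in> sphere 0 1" using False by simp
    from s(2)[OF this] S(2)[OF this] show ?thesis
      unfolding scale[OF False]
      by (simp add: mult.commute[of _ "norm a"] mult_left_mono)
  qed (simp add: norm_W_def)
  moreover have "s \<noteq> 0" "S \<noteq> 0" using s(1) S(1) by auto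
  ultimately show thesis using that pos by blast
qed

lemma tendsto_norm_W_iff: "X \<longlonglongrightarrow> l \<longleftrightarrow> (\<lambda>k. norm_W W (X k - l)) \<longlonglongrightarrow> 0"
proof -
  obtain m K where mK: "0 < m" "0 < K" "\<And>a. m * norm a \<le> norm_W W a"
    "\<And>a. norm_W W a \<le> K * norm a"
    using norm_W_equivalent by blast
  show ?thesis
  proof
    assume "X \<longlonglongrightarrow> l"
    from tendsto_mult_right_zero[OF tendsto_norm_zero[OF LIM_zero[OF this]], of K]
    show "(\<lambda>k. norm_W W (X k - l)) \<longlonglongrightarrow> 0"
      by (rule Lim_null_comparison[rotated]) (simp add: mK(4))
  next
    assume "(\<lambda>k. norm_W W (X k - l)) \<longlonglongrightarrow> 0"
    from tendsto_mult_right_zero[OF this, of "1 / m"]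
    have "(\<lambda>k. X k - l) \<longlonglongrightarrow> 0"
      by (rule Lim_null_comparison[rotated]) (use mK(1,3) in \<open>simp add: field_simps\<close>)
    then show "X \<longlonglongrightarrow> l" by (rule LIM_zero_cancel)
  qed
qed

lemma bounded_norm_W_iff: "bounded (range X) \<longleftrightarrow> (\<exists>B. \<forall>k::nat. norm_W W (X k) \<le> B)"
proof -
  obtain m K where mK: "0 < m" "0 < K" "\<And>a. m * norm a \<le> norm_W W a"
    "\<And>a. norm_W W a \<le> K * norm a"
    using norm_W_equivalent by blast
  have "\<exists>B. \<forall>k. norm_W W (X k) \<le> B" if B: "\<forall>k. norm (X k) \<le> B" for B
    by (rule exI[of _ "K * B"]) (meson B mK(2,4) order_trans mult_left_mono less_imp_le)
  moreover have "\<exists>B. \<forall>k. norm (X k) \<le> B" if B: "\<forall>k. norm_W W (X k) \<le> B" for B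
  proof (intro exI allI)
    fix k
    have "m * norm (X k) \<le> B" using mK(3) B order_trans by blast
    then show "norm (X k) \<le> B / m" using mK(1) by (simp add: field_simps)
  qed
  ultimately show ?thesis by (auto simp: bounded_iff)
qed

lemma matrix_inv_spd:
  "W *v (matrix_inv W *v a) = a" "matrix_inv W *v (W *v a) = a"
proof -
  have "inj ((*v) W)"
  proof (rule linear_injective_0[THEN iffD2, rule_format])
    show "linear ((*v) W)" by simp
    fix a assume "W *v a = 0"
    then show "a = 0" using inner_W_pos[of a] by (auto simp: inner_W_def)
  qed
  then have "invertible W"
    by (metis invertible_left_inverse matrix_left_invertible_injective)
  then have "W ** matrix_inv W = mat 1 \<and> matrix_inv W ** W = mat 1"
    unfolding invertible_def matrix_inv_def by (rule someI_ex)
  then show "W *v (matrix_inv W *v a) = a" "matrix_inv W *v (W *v a) = a"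
    by (simp_all add: matrix_vector_mul_assoc)
qed

end

section \<open>Optimality and error bounds for approximate minimizers\<close>

text \<open>The quadratic term is strongly convex in \<open>L *v x\<close> only, so the tolerance
  controls the distance between images under \<open>L\<close>, not between the points. The last
  bound retains the value of \<open>h\<close> at the approximate point, from which primal optimality
  is read off later. \<open>L\<close> is \<open>M\<close> in the \<open>x\<close>-step and the
  identity in the \<open>z\<close>-step.\<close>

lemma approx_step:
  fixes h :: "real^'n \<Rightarrow> ereal" and L :: "real^'n^'m"
  assumes h: "closed_proper_convex h" and W: "symmetric_positive_definite W"
    and x: "x \<in> approx_argmin \<tau> UNIV (x_obj h L W c p z)"
    and att: "\<exists>x'. minimizer (x_obj h L W c p z) x'"
  obtains u a where "h u = ereal a"
    and "\<And>y. ereal (a + (p + c *\<^sub>R (W *v (L *v u - z))) \<bullet> (L *v u - L *v y)) \<le> h y"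
    and "c / 2 * (norm_W W (L *v x - L *v u))\<^sup>2 \<le> \<tau>"
    and "h x \<le> ereal (a + p \<bullet> (L *v u - L *v x) + c / 2 * (norm_W W (L *v u - z))\<^sup>2
                        - c / 2 * (norm_W W (L *v x - z))\<^sup>2 + \<tau>)"
proof -
  have cvx: "convex (ereal_epigraph h)" and not_MInf: "\<And>y. h y \<noteq> - \<infinity>" "\<exists>y. h y \<noteq> \<infinity>"
    using h by (auto simp: closed_proper_convex_def proper_def)
  define Q where "Q y = p \<bullet> (L *v y) + c / 2 * (norm_W W (L *v y - z))\<^sup>2" for y
  have obj: "x_obj h L W c p z y = h y + ereal (Q y)" for y
    by (cases "h y") (auto simp: x_obj_def Q_def)
  obtain u where u: "\<And>y. h u + ereal (Q u) \<le> h y + ereal (Q y)"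
    using att by (auto simp: is_arg_min_linorder obj)
  have "h u \<noteq> \<infinity>"
  proof
    assume "h u = \<infinity>"
    moreover obtain y where "h y \<noteq> \<infinity>" using not_MInf by blast
    ultimately show False using u[of y] by auto
  qed
  then obtain a where a: "h u = ereal a" using not_MInf(1)[of u] by (cases "h u") auto
  have min: "a + Q u \<le> r + Q w" if "h w \<le> ereal r" for w r
    using u[of w] that not_MInf(1)[of w] by (cases "h w") (auto simp: a)
  define D where "D y = (p + c *\<^sub>R (W *v (L *v u - z))) \<bullet> (L *v y - L *v u)" for y
  define K where "K y = c / 2 * (norm_W W (L *v y - L *v u))\<^sup>2" for y
  have Q: "Q ((1 - t) *\<^sub>R u + t *\<^sub>R y) = Q u + t * D y + t\<^sup>2 * K y" for t y
  proof -
    define A d where "A = L *v u - z" and "d = L *v y - L *v u"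
    have 1: "L *v ((1 - t) *\<^sub>R u + t *\<^sub>R y) = L *v u + t *\<^sub>R d"
      by (simp add: d_def matrix_vector_right_distrib matrix_vector_mult_scaleR algebra_simps)
    have 2: "L *v u + t *\<^sub>R d - z = A + t *\<^sub>R d" by (simp add: A_def)
    have D: "D y = p \<bullet> d + c * inner_W W d A"
      by (simp add: D_def A_def[symmetric] d_def[symmetric] inner_W_def inner_simps inner_commute)
    show ?thesis
      unfolding Q_def K_def D 1 2 A_def[symmetric] d_def[symmetric] norm_W_square[OF W]
      by (simp add: inner_W_linear inner_W_commute[OF W, of A d] inner_simps
          power2_eq_square algebra_simps)
  qed
  have Q1: "Q y = Q u + D y + K y" for y using Q[of 1 y] by simp
  have D: "a \<le> b + D y" if "h y \<le> ereal b" for b y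
    by (rule minimizer_convex_plus[OF cvx _ that, where Q = Q and K = "K y" and x = u])
      (auto simp: a min Q)
  have sub: "ereal (a + (p + c *\<^sub>R (W *v (L *v u - z))) \<bullet> (L *v u - L *v y)) \<le> h y" for y
    using D[of y "real_of_ereal (h y)"] not_MInf(1)[of y]
    by (cases "h y") (auto simp: D_def inner_diff_right)
  have "h x + ereal (Q x) \<le> (INF y. h y + ereal (Q y)) + ereal \<tau>"
    using x by (simp add: approx_argmin_def obj)
  also have "\<dots> \<le> (h u + ereal (Q u)) + ereal \<tau>"
    by (intro add_right_mono INF_lower) auto
  finally have le: "h x + ereal (Q x) \<le> ereal (a + Q u + \<tau>)" by (simp add: a)
  then obtain b where b: "h x = ereal b" using not_MInf(1)[of x] by (cases "h x") auto
  have b_le: "b + Q x \<le> a + Q u + \<tau>" using le b by simp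
  \<comment> \<open>The objective gap between \<open>x\<close> and \<open>u\<close> is
    \<open>(b - a + D x) + K x\<close>, and the bracket is nonnegative by optimality of
    \<open>u\<close>.\<close>
  have "K x \<le> \<tau>" using D[of x b] b b_le Q1[of x] by simp
  moreover have "h x \<le> ereal (a + p \<bullet> (L *v u - L *v x) + c / 2 * (norm_W W (L *v u - z))\<^sup>2
                        - c / 2 * (norm_W W (L *v x - z))\<^sup>2 + \<tau>)"
    using b_le by (simp add: b Q_def inner_diff_right)
  ultimately show thesis using that[OF a sub] by (simp add: K_def)
qed

text \<open>Lets \<open>approx_step\<close> serve both minimizations; the multiplier changes
  sign.\<close>

lemma z_obj_eq_x_obj:
  assumes "symmetric_positive_definite W"
  shows "z_obj g W c p w = x_obj g (mat 1) W c (- p) w"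
proof
  fix z show "z_obj g W c p w z = x_obj g (mat 1) W c (- p) w z"
    by (cases "g z") (auto simp: z_obj_def x_obj_def norm_W_minus_commute[OF assms, of w z])
qed

section \<open>Conjugates, dual solutions and strong duality\<close>

lemma conjugate_ge: "h x = ereal a \<Longrightarrow> ereal (p \<bullet> x - a) \<le> conjugate h p"
  unfolding conjugate_def by (rule SUP_upper2[of x]) auto

lemma conjugate_le:
  assumes "\<And>x. ereal (p \<bullet> x - \<beta>) \<le> h x"
  shows "conjugate h p \<le> ereal \<beta>"
  unfolding conjugate_def
proof (rule SUP_least)
  fix x show "ereal (p \<bullet> x) - h x \<le> ereal \<beta>"
    using assms[of x] by (cases "h x") auto
qed

lemma inner_neg_transpose:
  fixes M :: "real^'n^'m"
  shows "(- (transpose M *v q)) \<bullet> x = - (q \<bullet> (M *v x))"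
  by (simp add: transpose_matrix_vector dot_lmul_matrix)

lemma conjugate_transpose_ge:
  fixes M :: "real^'n^'m"
  assumes "f x = ereal a"
  shows "ereal (- (q \<bullet> (M *v x)) - a) \<le> conjugate f (- (transpose M *v q))"
  using conjugate_ge[of f x a "- (transpose M *v q)"] assms
  by (simp add: inner_neg_transpose del: inner_minus_left)

lemma conjugate_transpose_le:
  fixes M :: "real^'n^'m"
  assumes "\<And>x. ereal (\<alpha> - q \<bullet> (M *v x)) \<le> f x"
  shows "conjugate f (- (transpose M *v q)) \<le> ereal (- \<alpha>)"
  by (rule conjugate_le) (use assms in \<open>simp add: inner_neg_transpose del: inner_minus_left\<close>)

text \<open>
  A pair \<open>(z, p)\<close> with \<open>z \<in> \<partial>g\<^sup>*(p)\<close> and \<open>- z \<in> \<partial>(f\<^sup>* \<circ> (- M\<^sup>T))(p)\<close>. The point \<open>z\<close> need not be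
  of the form \<open>M x\<close>; the number \<open>\<alpha>\<close> is \<open>- f\<^sup>*(- M\<^sup>T p)\<close>.
\<close>

definition splitting_solution ::
    "(real^'n \<Rightarrow> ereal) \<Rightarrow> (real^'m \<Rightarrow> ereal) \<Rightarrow> real^'n^'m \<Rightarrow> real^'m \<Rightarrow> real^'m \<Rightarrow> bool"
  where "splitting_solution f g M z p \<longleftrightarrow>
    (\<exists>b. g z = ereal b \<and> (\<forall>v. ereal (b + p \<bullet> (v - z)) \<le> g v)) \<and>
    (\<exists>\<alpha>. (\<forall>x. ereal (\<alpha> - p \<bullet> (M *v x)) \<le> f x) \<and>
         (\<forall>q. ereal (- \<alpha> - z \<bullet> (q - p)) \<le> conjugate f (- (transpose M *v q))))"

text \<open>The defining inequalities pin both conjugates at \<open>p\<close> to real numbers.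
  Adding the lower bounds at \<open>q\<close> cancels every term in \<open>q\<close>, which leaves
  the dual value at \<open>p\<close>.\<close>

lemma splitting_solution_dual:
  assumes "splitting_solution f g M z p"
  shows "minimizer (dual_obj f g M) p"
    and "z \<in> subdifferential (conjugate g) p"
    and "- z \<in> subdifferential (\<lambda>q. conjugate f (- (transpose M *v q))) p"
proof -
  obtain b \<alpha> where b: "g z = ereal b" "\<And>v. ereal (b + p \<bullet> (v - z)) \<le> g v"
    and \<alpha>: "\<And>x. ereal (\<alpha> - p \<bullet> (M *v x)) \<le> f x"
      "\<And>q. ereal (- \<alpha> - z \<bullet> (q - p)) \<le> conjugate f (- (transpose M *v q))"
    using assms unfolding splitting_solution_def by blast
  have g_le: "conjugate g p \<le> ereal (p \<bullet> z - b)"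
    by (rule conjugate_le) (use b(2) in \<open>simp add: inner_diff_right algebra_simps\<close>)
  have f_le: "conjugate f (- (transpose M *v p)) \<le> ereal (- \<alpha>)"
    by (rule conjugate_transpose_le) (rule \<alpha>)
  have g_ge: "ereal (q \<bullet> z - b) \<le> conjugate g q" for q
    by (rule conjugate_ge) (rule b)
  have g_eq: "conjugate g p = ereal (p \<bullet> z - b)" using g_le g_ge[of p] by simp
  have f_eq: "conjugate f (- (transpose M *v p)) = ereal (- \<alpha>)"
    using f_le \<alpha>(2)[of p] by simp
  show "z \<in> subdifferential (conjugate g) p"
    using g_ge by (simp add: subdifferential_def g_eq inner_diff_right inner_commute)
  show "- z \<in> subdifferential (\<lambda>q. conjugate f (- (transpose M *v q))) p"
    using \<alpha>(2) by (simp add: subdifferential_def f_eq inner_diff_right algebra_simps)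
  have "dual_obj f g M p \<le> dual_obj f g M q" for q
  proof -
    have "ereal (- \<alpha> - z \<bullet> (q - p)) + ereal (q \<bullet> z - b) \<le> dual_obj f g M q"
      unfolding dual_obj_def using \<alpha>(2) g_ge by (rule add_mono)
    then show ?thesis
      by (simp add: dual_obj_def f_eq g_eq inner_diff_right inner_commute)
  qed
  then show "minimizer (dual_obj f g M) p" by (simp add: is_arg_min_linorder)
qed

lemma conjugate_proper_not_MInf:
  assumes "proper h" shows "conjugate h p \<noteq> - \<infinity>"
proof -
  obtain x where "h x \<noteq> \<infinity>" "h x \<noteq> - \<infinity>" using assms by (auto simp: proper_def)
  then obtain a where "h x = ereal a" by (cases "h x") auto
  then have "ereal (p \<bullet> x - a) \<le> conjugate h p" by (rule conjugate_ge)
  then show ?thesis by auto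
qed

text \<open>Two Fenchel inequalities whose sum is an equality are both tight, and tightness gives
  the subgradient inequalities with \<open>z = M *v x\<close>.\<close>

lemma strong_duality_imp_solution:
  assumes f: "proper f" and g: "proper g" and sd: "strong_duality f g M"
  shows "\<exists>z p. splitting_solution f g M z p"
proof -
  obtain x p where eq: "(f x + g (M *v x)) +
      (conjugate f (- (transpose M *v p)) + conjugate g p) = 0"
    using sd by (auto simp: strong_duality_def primal_obj_def dual_obj_def)
  have ninf: "f x \<noteq> - \<infinity>" "g (M *v x) \<noteq> - \<infinity>"
    using f g by (auto simp: proper_def)
  \<comment> \<open>Properness rules out \<open>- \<infinity>\<close> in all four terms, so a single
    infinite term would make the sum \<open>\<infinity>\<close> instead of \<open>0\<close>.\<close>
  obtain a b where ab: "f x = ereal a" "g (M *v x) = ereal b"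
    using eq ninf conjugate_proper_not_MInf[OF f, of "- (transpose M *v p)"]
      conjugate_proper_not_MInf[OF g, of p]
    by (cases "f x"; cases "g (M *v x)"; cases "conjugate f (- (transpose M *v p))";
        cases "conjugate g p") auto
  obtain a' b' where ab': "conjugate f (- (transpose M *v p)) = ereal a'"
      "conjugate g p = ereal b'"
    using eq ab conjugate_proper_not_MInf[OF f, of "- (transpose M *v p)"]
      conjugate_proper_not_MInf[OF g, of p]
    by (cases "conjugate f (- (transpose M *v p))"; cases "conjugate g p") auto
  have sum: "a + b + (a' + b') = 0" using eq by (simp add: ab ab')
  have "- (p \<bullet> (M *v x)) - a \<le> a'"
    using conjugate_transpose_ge[of f x a p M] ab ab' by simp
  moreover have "p \<bullet> (M *v x) - b \<le> b'"
    using conjugate_ge[of g "M *v x" b p] ab ab' by simp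
  ultimately have a': "a' = - (p \<bullet> (M *v x)) - a" and b': "b' = p \<bullet> (M *v x) - b"
    using sum by auto
  have "ereal (b + p \<bullet> (v - M *v x)) \<le> g v" for v
  proof (cases "g v")
    case (real r)
    then show ?thesis
      using conjugate_ge[of g v r p] by (simp add: ab' b' inner_diff_right)
  qed (use g in \<open>auto simp: proper_def\<close>)
  moreover have "ereal (- a' - p \<bullet> (M *v y)) \<le> f y" for y
  proof (cases "f y")
    case (real r)
    then show ?thesis
      using conjugate_transpose_ge[of f y r p M] by (simp add: ab')
  qed (use f in \<open>auto simp: proper_def\<close>)
  moreover have "ereal (a' - (M *v x) \<bullet> (q - p)) \<le> conjugate f (- (transpose M *v q))" for q
  proof -
    have "a' - (M *v x) \<bullet> (q - p) = - (q \<bullet> (M *v x)) - a"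
      by (simp add: a' inner_diff_right inner_commute)
    then show ?thesis using conjugate_transpose_ge[of f x a q M] ab(1) by simp
  qed
  ultimately have "splitting_solution f g M (M *v x) p"
    unfolding splitting_solution_def using ab(2)
    by (intro conjI exI[of _ b] exI[of _ "- a'"]) auto
  then show ?thesis by blast
qed

section \<open>Attainment in the image of a linear map\<close>

lemma subgradient_affine_minorant:
  assumes "proper f" "v \<in> subdifferential f x"
  obtains C where "\<And>y. ereal (v \<bullet> y - C) \<le> f y"
proof -
  have v: "f x + ereal (v \<bullet> (y - x)) \<le> f y" for y
    using assms(2) by (auto simp: subdifferential_def)
  obtain w where "f w \<noteq> \<infinity>" using assms(1) by (auto simp: proper_def)
  then have "f x \<noteq> \<infinity>" using v[of w] by auto
  moreover have "f x \<noteq> - \<infinity>" using assms(1) by (auto simp: proper_def)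
  ultimately obtain a where "f x = ereal a" by (cases "f x") auto
  then have "ereal (v \<bullet> y - (v \<bullet> x - a)) \<le> f y" for y
    using v[of y] by (simp add: inner_diff_right algebra_simps)
  then show thesis using that by blast
qed

text \<open>The point minimizes \<open>f\<close> plus \<open>\<kappa>\<close> times the squared
  distance to \<open>y\<close>, minus the linear form of \<open>u\<close>. Optimality makes
  \<open>u + (2 * \<kappa>) *\<^sub>R (y - x)\<close> a subgradient at \<open>x\<close>, so
  \<open>orth\<close> gives \<open>(y - x) \<bullet> w = 0\<close>; the first-order inequality
  tested at \<open>y + w\<close> then yields both bounds.\<close>

lemma prox_point:
  fixes f :: "'a::euclidean_space \<Rightarrow> ereal"
  assumes cl: "closed (ereal_epigraph f)" and cvx: "convex (ereal_epigraph f)"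
    and lower: "\<And>y. ereal (u \<bullet> y - C) \<le> f y"
    and orth: "\<And>x v. v \<in> subdifferential f x \<Longrightarrow> (v - u) \<bullet> w = 0"
    and r: "f (y + w) \<le> ereal r" and \<kappa>: "\<kappa> > 0"
  obtains x where "f x \<le> ereal (r - u \<bullet> (y + w - x))"
    and "2 * \<kappa> * (norm (x - y))\<^sup>2 \<le> r - u \<bullet> (y + w) + C"
proof -
  define Q where "Q x = \<kappa> * (norm (x - y))\<^sup>2 - u \<bullet> x" for x
  define K where "K = r + Q (y + w)"
  \<comment> \<open>A sublevel set taken inside the epigraph: the objective is continuous there, and
    the affine minorant with the quadratic term makes the set compact, so a minimum exists.\<close>
  define S where "S = ereal_epigraph f \<inter> {s. snd s + Q (fst s) \<le> K}"
  have low: "u \<bullet> x - C \<le> s" if "f x \<le> ereal s" for x s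
    using order_trans[OF lower that] by simp
  have "closed {s. snd s + Q (fst s) \<le> K}"
    unfolding Q_def by (intro closed_Collect_le continuous_intros)
  then have "closed S" unfolding S_def using cl by (intro closed_Int)
  moreover have "bounded S"
  proof -
    have x: "norm x \<le> norm y + ((K + C) / \<kappa> + 1)" if "(x, s) \<in> S" for x s
    proof -
      have "\<kappa> * (norm (x - y))\<^sup>2 \<le> K + C"
        using that low[of x s] by (auto simp: S_def ereal_epigraph_def Q_def)
      then have "(norm (x - y))\<^sup>2 \<le> (K + C) / \<kappa>" using \<kappa> by (simp add: field_simps)
      moreover have "norm (x - y) \<le> (norm (x - y))\<^sup>2 + 1"
        using zero_le_power2[of "norm (x - y) - 1"] norm_ge_zero[of "x - y"]
        unfolding power2_diff one_power2 mult_1_right by linarith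
      ultimately show ?thesis using norm_triangle_sub[of x y] by linarith
    qed
    define R where "R = norm y + ((K + C) / \<kappa> + 1)"
    have s: "\<bar>s\<bar> \<le> \<bar>K\<bar> + \<bar>C\<bar> + norm u * R" if "(x, s) \<in> S" for x s
    proof -
      have "\<bar>u \<bullet> x\<bar> \<le> norm u * R"
        using x[OF that] Cauchy_Schwarz_ineq2[of u x]
        by (metis R_def mult_left_mono norm_ge_zero order_trans)
      moreover have "0 \<le> \<kappa> * (norm (x - y))\<^sup>2" using \<kappa> by simp
      moreover have "s + (\<kappa> * (norm (x - y))\<^sup>2 - u \<bullet> x) \<le> K" "u \<bullet> x - C \<le> s"
        using that low[of x s] by (auto simp: S_def ereal_epigraph_def Q_def)
      ultimately show ?thesis by linarith
    qed
    have "norm a \<le> R + (\<bar>K\<bar> + \<bar>C\<bar> + norm u * R)" if "a \<in> S" for a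
      using norm_Pair_le[of "fst a" "snd a"] x[of "fst a" "snd a"] s[of "fst a" "snd a"] that
      by (simp add: R_def)
    then show ?thesis by (meson boundedI)
  qed
  ultimately have "compact S" by (simp add: compact_eq_bounded_closed)
  moreover have "(y + w, r) \<in> S" using r by (simp add: S_def ereal_epigraph_def K_def)
  moreover have "continuous_on S (\<lambda>s. snd s + Q (fst s))"
    unfolding Q_def by (intro continuous_intros)
  ultimately obtain m where m: "m \<in> S" "\<And>s. s \<in> S \<Longrightarrow> snd m + Q (fst m) \<le> snd s + Q (fst s)"
    using continuous_attains_inf[of S "\<lambda>s. snd s + Q (fst s)"] by blast
  define x a where "x = fst m" and "a = snd m"
  have fx_le: "f x \<le> ereal a" using m(1) by (auto simp: S_def ereal_epigraph_def x_def a_def)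
  have min: "a + Q x \<le> s + Q v" if "f v \<le> ereal s" for v s
  proof (cases "s + Q v \<le> K")
    case True
    then show ?thesis
      using m(2)[of "(v, s)"] that by (simp add: S_def ereal_epigraph_def x_def a_def)
  next
    case False
    then show ?thesis using m(1) by (auto simp: S_def x_def a_def)
  qed
  have fx: "f x = ereal a"
  proof (cases "f x")
    case (real s)
    then show ?thesis using fx_le min[of x s] by simp
  qed (use fx_le lower[of x] in auto)
  define D where "D v = (2 * \<kappa>) * ((x - y) \<bullet> (v - x)) - u \<bullet> (v - x)" for v
  have Q: "Q ((1 - t) *\<^sub>R x + t *\<^sub>R v) = Q x + t * D v + t\<^sup>2 * (\<kappa> * (norm (v - x))\<^sup>2)" for t v
  proof -
    define A d where "A = x - y" and "d = v - x"
    have 1: "(1 - t) *\<^sub>R x + t *\<^sub>R v = x + t *\<^sub>R d" "x + t *\<^sub>R d - y = A + t *\<^sub>R d"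
      by (simp_all add: A_def d_def algebra_simps)
    show ?thesis
      unfolding Q_def D_def 1 A_def[symmetric] d_def[symmetric] power2_norm_eq_inner
      by (simp add: inner_simps inner_commute[of d A] power2_eq_square algebra_simps)
  qed
  have D: "a \<le> s + D v" if "f v \<le> ereal s" for v s
    by (rule minimizer_convex_plus[OF cvx fx_le that, where Q = Q
        and K = "\<kappa> * (norm (v - x))\<^sup>2"]) (auto simp: min Q)
  have "u + (2 * \<kappa>) *\<^sub>R (y - x) \<in> subdifferential f x"
  proof (unfold subdifferential_def, safe)
    fix v
    show "f x + ereal ((u + (2 * \<kappa>) *\<^sub>R (y - x)) \<bullet> (v - x)) \<le> f v"
    proof (cases "f v")
      case (real s)
      have "(u + (2 * \<kappa>) *\<^sub>R (y - x)) \<bullet> (v - x) = - D v"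
        unfolding D_def by (simp add: inner_simps algebra_simps)
      then show ?thesis using D[of v s] real by (simp add: fx)
    qed (use lower[of v] in auto)
  qed
  from orth[OF this] have w: "(y - x) \<bullet> w = 0" using \<kappa> by simp
  have "D (y + w) = - (2 * \<kappa>) * (norm (x - y))\<^sup>2 - u \<bullet> (y + w - x)"
  proof -
    have "(x - y) \<bullet> (y + w - x) = - ((x - y) \<bullet> (x - y))"
      using w by (simp add: inner_simps algebra_simps)
    then show ?thesis by (simp add: D_def power2_norm_eq_inner)
  qed
  with D[OF r] have *: "a \<le> r - u \<bullet> (y + w - x) - 2 * \<kappa> * (norm (x - y))\<^sup>2" by simp
  show thesis
  proof
    have "a \<le> r - u \<bullet> (y + w - x)" using * \<kappa> by (smt (verit) mult_nonneg_nonneg zero_le_power2)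
    then show "f x \<le> ereal (r - u \<bullet> (y + w - x))" using fx by simp
    show "2 * \<kappa> * (norm (x - y))\<^sup>2 \<le> r - u \<bullet> (y + w) + C"
      using * low[OF fx_le] by (simp add: inner_simps)
  qed
qed

text \<open>
  The proximal points \<open>x\<close> of \<open>y\<close> satisfy \<open>(y - x) \<bullet> w = 0\<close>, and the subgradient inequality between
  \<open>x\<close> and \<open>y + w\<close> then passes to the limit as the proximal parameter \<open>\<kappa>\<close> tends to infinity.
\<close>

lemma translation_invariant_of_orthogonal_subgradients:
  fixes f :: "'a::euclidean_space \<Rightarrow> ereal"
  assumes cl: "closed (ereal_epigraph f)" and cvx: "convex (ereal_epigraph f)"
    and lower: "\<And>y. ereal (u \<bullet> y - C) \<le> f y"
    and orth: "\<And>x v. v \<in> subdifferential f x \<Longrightarrow> (v - u) \<bullet> w = 0"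
    and r: "f (y + w) \<le> ereal r"
  shows "f y \<le> ereal (r - u \<bullet> w)"
proof -
  define E where "E = r - u \<bullet> (y + w) + C"
  have "\<exists>x. f x \<le> ereal (r - u \<bullet> (y + w - x)) \<and> 2 * real (Suc n) * (norm (x - y))\<^sup>2 \<le> E" for n
  proof -
    have "real (Suc n) > 0" by simp
    from prox_point[OF cl cvx lower _ r this] orth show ?thesis
      unfolding E_def by metis
  qed
  then obtain x where x: "\<And>n. f (x n) \<le> ereal (r - u \<bullet> (y + w - x n))"
    "\<And>n. 2 * real (Suc n) * (norm (x n - y))\<^sup>2 \<le> E" by metis
  have "(\<lambda>n. E * (1 / real (Suc n))) \<longlonglongrightarrow> E * 0"
    by (intro tendsto_mult tendsto_const lim_1_over_n[THEN LIMSEQ_Suc])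
  then have "(\<lambda>n. E * (1 / real (Suc n))) \<longlonglongrightarrow> 0" by simp
  then have "(\<lambda>n. (norm (x n - y))\<^sup>2) \<longlonglongrightarrow> 0"
  proof (rule Lim_null_comparison[rotated], intro always_eventually allI)
    fix n
    have "real (Suc n) * (norm (x n - y))\<^sup>2 \<le> 2 * real (Suc n) * (norm (x n - y))\<^sup>2"
      by (simp add: mult_right_mono)
    with x(2)[of n] have "real (Suc n) * (norm (x n - y))\<^sup>2 \<le> E" by linarith
    then show "norm ((norm (x n - y))\<^sup>2) \<le> E * (1 / real (Suc n))"
      by (simp add: field_simps)
  qed
  then have "(\<lambda>n. norm (x n - y)) \<longlonglongrightarrow> 0"
    using tendsto_real_sqrt[of "\<lambda>n. (norm (x n - y))\<^sup>2" 0 sequentially] by simp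
  then have "x \<longlonglongrightarrow> y" by (simp add: tendsto_norm_zero_iff LIM_zero_iff)
  moreover from this have "(\<lambda>n. r - u \<bullet> (y + w - x n)) \<longlonglongrightarrow> r - u \<bullet> (y + w - y)"
    by (intro tendsto_intros)
  ultimately show ?thesis
    using closed_epigraph_limit[OF cl, of x y _ "r - u \<bullet> (y + w - y)"] x(1) by simp
qed

text \<open>
  With \<open>L\<close> the direction space of the affine hull of \<open>im \<partial>f\<close>, the function
  \<open>x \<mapsto> f x - q \<bullet> M x\<close> grows at least linearly along \<open>L\<close> and is invariant along the orthogonal
  complement of \<open>L\<close>. So the components in \<open>L\<close> of the given sequence are bounded.
\<close>

lemma image_limit_attained:
  fixes f :: "real^'n \<Rightarrow> ereal" and M :: "real^'n^'m" and X :: "nat \<Rightarrow> real^'n"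
  assumes f: "closed_proper_convex f"
    and ri: "transpose M *v q \<in> rel_interior (\<Union>y. subdifferential f y)"
    and lim: "(\<lambda>k. M *v X k) \<longlonglongrightarrow> z" and up: "\<And>k. f (X k) \<le> ereal A"
  obtains xs where "M *v xs = z"
    and "\<And>\<beta> b. \<beta> \<longlonglongrightarrow> b \<Longrightarrow> (\<And>k. f (X k) \<le> ereal (\<beta> k)) \<Longrightarrow> f xs \<le> ereal b"
proof -
  have cl: "closed (ereal_epigraph f)" and cvx: "convex (ereal_epigraph f)" and pf: "proper f"
    using f by (auto simp: closed_proper_convex_def)
  define E where "E = (\<Union>y. subdifferential f y)"
  define u where "u = transpose M *v q"
  have u_M: "u \<bullet> x = q \<bullet> (M *v x)" for x
    by (simp add: u_def transpose_matrix_vector dot_lmul_matrix)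
  obtain e where e: "e > 0" "ball u e \<inter> affine hull E \<subseteq> E" and uE: "u \<in> E"
    using ri by (auto simp: mem_rel_interior_ball E_def u_def)
  have u_hull: "u \<in> affine hull E" using uE by (rule hull_inc)
  define L where "L = (\<lambda>x. - u + x) ` (affine hull E)"
  have "subspace L" unfolding L_def by (rule affine_diffs_subspace) (auto simp: u_hull)
  then obtain B where B: "B \<subseteq> L" "pairwise orthogonal B" "\<And>b. b \<in> B \<Longrightarrow> norm b = 1"
      "independent B" "span B = L"
    using orthonormal_basis_subspace by metis
  have finB: "finite B" using B(4) by (rule independent_imp_finite)
  have minorant: "\<exists>C. \<forall>y. ereal (v \<bullet> y - C) \<le> f y" if "v \<in> E" for v
    using that subgradient_affine_minorant[OF pf, of v] unfolding E_def by (metis UN_E)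
  have shift: "u + t *\<^sub>R b \<in> E" if "b \<in> B" "\<bar>t\<bar> < e" for t b
  proof -
    have "t *\<^sub>R b \<in> L" using that B(1) \<open>subspace L\<close> by (auto intro: subspace_scale)
    then have "u + t *\<^sub>R b \<in> affine hull E" by (auto simp: L_def)
    moreover have "u + t *\<^sub>R b \<in> ball u e" using that B(3) by (simp add: dist_norm)
    ultimately show ?thesis using e(2) by blast
  qed
  obtain Uq where Uq: "\<And>k. norm (M *v X k) \<le> Uq"
    using convergent_imp_Bseq[OF convergentI[OF lim]] by (auto simp: Bseq_def)
  have u_bd: "\<bar>u \<bullet> X k\<bar> \<le> norm q * Uq" for k
    unfolding u_M using Cauchy_Schwarz_ineq2[of q "M *v X k"] Uq[of k]
    by (meson mult_left_mono norm_ge_zero order_trans)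
  \<comment> \<open>The subgradients \<open>u + (e/2) *\<^sub>R b\<close> and
    \<open>u - (e/2) *\<^sub>R b\<close> bound the component along \<open>b\<close> from both sides;
    \<open>u \<bullet> X k\<close> is bounded because \<open>u\<close> lies in the range of
    \<open>transpose M\<close>.\<close>
  have comp: "\<exists>K. \<forall>k. \<bar>X k \<bullet> b\<bar> \<le> K" if b: "b \<in> B" for b
  proof -
    obtain C1 where C1: "\<And>y. ereal ((u + (e/2) *\<^sub>R b) \<bullet> y - C1) \<le> f y"
      using minorant[OF shift[OF b, of "e/2"]] e(1) by auto
    obtain C2 where C2: "\<And>y. ereal ((u + (- (e/2)) *\<^sub>R b) \<bullet> y - C2) \<le> f y"
      using minorant[OF shift[OF b, of "- (e/2)"]] e(1) by auto
    have "\<bar>X k \<bullet> b\<bar> \<le> (\<bar>A\<bar> + norm q * Uq + \<bar>C1\<bar> + \<bar>C2\<bar>) / (e/2)" for k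
    proof -
      have "(u + (e/2) *\<^sub>R b) \<bullet> X k - C1 \<le> A" "(u + (- (e/2)) *\<^sub>R b) \<bullet> X k - C2 \<le> A"
        using order_trans[OF C1 up] order_trans[OF C2 up] by auto
      then have "u \<bullet> X k + (e/2) * (X k \<bullet> b) - C1 \<le> A" "u \<bullet> X k - (e/2) * (X k \<bullet> b) - C2 \<le> A"
        by (auto simp: inner_simps inner_commute)
      then have "\<bar>(e/2) * (X k \<bullet> b)\<bar> \<le> \<bar>A\<bar> + norm q * Uq + \<bar>C1\<bar> + \<bar>C2\<bar>"
        using u_bd[of k] by linarith
      then show ?thesis using e(1) by (simp add: abs_mult field_simps)
    qed
    then show ?thesis by blast
  qed
  then obtain K where K: "\<And>b k. b \<in> B \<Longrightarrow> \<bar>X k \<bullet> b\<bar> \<le> K b" by metis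
  \<comment> \<open>Orthogonal projection of \<open>X k\<close> onto \<open>L\<close>.\<close>
  define a where "a k = (\<Sum>b\<in>B. (X k \<bullet> b) *\<^sub>R b)" for k
  have "norm (a k) \<le> (\<Sum>b\<in>B. K b)" for k
    unfolding a_def by (rule sum_norm_le) (use K B(3) in auto)
  then have "bounded (range a)" by (auto simp: bounded_iff)
  then obtain as r where r: "strict_mono r" "(a \<circ> r) \<longlonglongrightarrow> as"
    using bounded_imp_convergent_subsequence by blast
  define N where "N = {w. \<forall>v\<in>L. v \<bullet> w = 0}"
  have "subspace N" unfolding subspace_def N_def by (auto simp: inner_simps)
  have N: "X k - a k \<in> N" for k
  proof -
    have "b \<bullet> (X k - a k) = 0" if "b \<in> B" for b
    proof -
      have "b \<bullet> a k = (\<Sum>b'\<in>B. if b' = b then X k \<bullet> b else 0)"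
        unfolding a_def inner_sum_right
      proof (rule sum.cong)
        fix b' assume "b' \<in> B"
        then show "b \<bullet> ((X k \<bullet> b') *\<^sub>R b') = (if b' = b then X k \<bullet> b else 0)"
          using B(2,3) that by (auto simp: pairwise_def orthogonal_def norm_eq_1)
      qed simp
      then show ?thesis using that finB by (simp add: inner_simps inner_commute)
    qed
    then have "v \<bullet> (X k - a k) = 0" if "v \<in> span B" for v
      using span_induct[OF that, of "\<lambda>v. v \<bullet> (X k - a k) = 0"]
      by (auto simp: subspace_def inner_simps)
    then show ?thesis using B(5) by (auto simp: N_def)
  qed
  \<comment> \<open>\<open>X k - a k\<close> may be unbounded, but the image of a subspace is closed
    in finite dimension, so the limit of the images still lifts to some \<open>d\<close> in
    \<open>N\<close>.\<close>
  have "closed ((*v) M ` N)"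
    by (intro closed_subspace linear_subspace_image matrix_vector_mul_linear \<open>subspace N\<close>)
  moreover have lim2: "(\<lambda>k. M *v (X (r k) - a (r k))) \<longlonglongrightarrow> z - M *v as"
    unfolding matrix_vector_mult_diff_distrib
    using LIMSEQ_subseq_LIMSEQ[OF lim r(1)] r(2)
    by (intro tendsto_diff) (auto simp: o_def intro!: tendsto_intros
        bounded_linear.tendsto[OF matrix_vector_mul_bounded_linear])
  ultimately have "z - M *v as \<in> (*v) M ` N"
    using N by (intro closed_sequentially[OF _ _ lim2]) auto
  then obtain d where d: "d \<in> N" "M *v d = z - M *v as" by auto
  obtain C where C: "\<And>y. ereal (u \<bullet> y - C) \<le> f y" using minorant[OF uE] by blast
  have inv: "f y \<le> ereal (s - u \<bullet> w)" if "f (y + w) \<le> ereal s" "w \<in> N" for y w s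
  proof (rule translation_invariant_of_orthogonal_subgradients[OF cl cvx C _ that(1)])
    fix x v assume "v \<in> subdifferential f x"
    then have "v \<in> affine hull E" by (intro hull_inc) (auto simp: E_def)
    then have "v - u \<in> L" by (auto simp: L_def)
    then show "(v - u) \<bullet> w = 0" using that(2) by (auto simp: N_def)
  qed
  show thesis
  proof
    show "M *v (as + d) = z" by (simp add: matrix_vector_right_distrib d)
  next
    fix \<beta> b assume \<beta>: "\<beta> \<longlonglongrightarrow> b" "\<And>k. f (X k) \<le> ereal (\<beta> k)"
    \<comment> \<open>Invariance is used twice, from \<open>X k\<close> to \<open>a k\<close> and
      then from \<open>as\<close> to \<open>as + d\<close>. The linear corrections cancel in the
      limit because \<open>u \<bullet> x\<close> depends on \<open>M *v x\<close> alone.\<close>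
    have "f (a k) \<le> ereal (\<beta> k - u \<bullet> (X k - a k))" for k
      by (rule inv) (use \<beta>(2)[of k] N in auto)
    then have "f ((a \<circ> r) k) \<le> ereal (\<beta> (r k) - u \<bullet> (X (r k) - a (r k)))" for k by simp
    moreover have "(\<lambda>k. \<beta> (r k) - u \<bullet> (X (r k) - a (r k))) \<longlonglongrightarrow> b - u \<bullet> d"
      unfolding u_M d using lim2 LIMSEQ_subseq_LIMSEQ[OF \<beta>(1) r(1)]
      by (auto intro!: tendsto_intros simp: o_def)
    ultimately have "f as \<le> ereal (b - u \<bullet> d)"
      using closed_epigraph_limit[OF cl r(2)] by simp
    moreover have "- d \<in> N" using d(1) by (auto simp: N_def)
    ultimately show "f (as + d) \<le> ereal b"
      using inv[of "as + d" "- d" "b - u \<bullet> d"] by simp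
  qed
qed

section \<open>Inexact relaxed Douglas--Rachford steps\<close>

text \<open>Subtracting the partial sums of \<open>s\<close> leaves a decreasing sequence bounded
  below by \<open>- suminf s\<close>.\<close>

lemma quasi_decreasing_convergent:
  fixes D s :: "nat \<Rightarrow> real"
  assumes "\<And>k. D (Suc k) \<le> D k + s k" "summable s" "\<And>k. 0 \<le> s k" "\<And>k. 0 \<le> D k"
  shows "convergent D"
proof -
  define T where "T k = (\<Sum>i<k. s i)" for k
  have T: "T \<longlonglongrightarrow> suminf s" unfolding T_def by (rule summable_LIMSEQ) fact
  have "decseq (\<lambda>k. D k - T k)"
    using assms(1) by (intro decseq_SucI) (simp add: T_def algebra_simps)
  moreover have "- suminf s \<le> D k - T k" for k
    using sum_le_suminf[OF assms(2), of "{..<k}"] assms(3) assms(4)[of k] by (simp add: T_def)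
  ultimately obtain L where "(\<lambda>k. D k - T k) \<longlonglongrightarrow> L" using decseq_convergent by metis
  from tendsto_add[OF this T] show ?thesis by (auto simp: convergent_def)
qed

context
  fixes W :: "real^'m^'m"
  assumes W: "symmetric_positive_definite W"
begin

text \<open>Here \<open>s\<close> and \<open>t\<close> are the deviations of \<open>z\<close> and
  \<open>\<pi>\<close> from a solution. Replacing them by \<open>s - \<epsilon>\<close> and
  \<open>t + \<epsilon>\<close> keeps their sum and makes their inner product nonnegative, so their
  difference is no longer than their sum. This controls the error made in the assumption on
  \<open>e\<close>, and \<open>\<nu> \<le> 2\<close> lets that error complete a square.\<close>

lemma fejer_step:
  assumes e: "inner_W W (t + e) (s + e) \<le> 0" and \<epsilon>: "0 \<le> inner_W W (t + \<epsilon>) (s - \<epsilon>)"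
    and \<nu>: "0 \<le> \<nu>" "\<nu> \<le> 2"
  shows "(norm_W W (s + t + \<nu> *\<^sub>R e))\<^sup>2 + \<nu> * (2 - \<nu>) * (norm_W W e)\<^sup>2
           \<le> (norm_W W (s + t) + 2 * norm_W W \<epsilon>)\<^sup>2"
    and "norm_W W (s - \<epsilon>) \<le> norm_W W (s + t)"
proof -
  note sq = norm_W_square[OF W] and comm = inner_W_commute[OF W] and nn = norm_W_nonneg[OF W]
  define s' t' where "s' = s - \<epsilon>" and "t' = t + \<epsilon>"
  have st: "s = s' + \<epsilon>" "t = t' - \<epsilon>" "s + t = s' + t'" by (auto simp: s'_def t'_def)
  have pos: "0 \<le> inner_W W t' s'" using \<epsilon> by (simp add: s'_def t'_def)
  have "(norm_W W (s' - t'))\<^sup>2 \<le> (norm_W W (s' + t'))\<^sup>2" "(norm_W W s')\<^sup>2 \<le> (norm_W W (s' + t'))\<^sup>2"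
    using pos inner_W_nonneg[OF W, of t'] unfolding sq
    by (auto simp: inner_W_linear comm[of s' t'])
  then have le: "norm_W W (s' - t') \<le> norm_W W (s' + t')" "norm_W W s' \<le> norm_W W (s' + t')"
    by (auto intro: power2_le_imp_le simp: nn)
  then show "norm_W W (s - \<epsilon>) \<le> norm_W W (s + t)" unfolding st(3) by (simp add: s'_def)
  define D \<eta> where "D = norm_W W (s' + t')" and "\<eta> = norm_W W \<epsilon>"
  have D\<eta>: "0 \<le> D" "0 \<le> \<eta>" by (auto simp: D_def \<eta>_def nn)
  have "inner_W W \<epsilon> (s' - t') \<le> \<eta> * norm_W W (s' - t')"
    unfolding \<eta>_def by (rule inner_W_le_norm_W[OF W])
  also have "\<dots> \<le> \<eta> * D" using le(1) D\<eta> by (auto simp: D_def intro: mult_left_mono)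
  finally have 1: "inner_W W \<epsilon> (s' - t') \<le> \<eta> * D" .
  have "inner_W W (t + e) (s + e) = inner_W W t' s' - inner_W W \<epsilon> (s' - t') - \<eta>\<^sup>2
      + inner_W W e (s' + t') + (norm_W W e)\<^sup>2"
    unfolding st(1,2) \<eta>_def sq
    by (simp add: inner_W_linear comm[of s' e] comm[of t' e] comm[of t' \<epsilon>] comm[of e \<epsilon>])
  then have 2: "inner_W W e (s' + t') \<le> - (norm_W W e)\<^sup>2 + \<eta> * D + \<eta>\<^sup>2"
    using e 1 pos by linarith
  have "(norm_W W (s' + t' + \<nu> *\<^sub>R e))\<^sup>2
      = D\<^sup>2 + 2 * \<nu> * inner_W W e (s' + t') + \<nu>\<^sup>2 * (norm_W W e)\<^sup>2"
    unfolding D_def sq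
    by (simp add: inner_W_linear comm[of s' e] comm[of t' e] power2_eq_square algebra_simps)
  also have "\<dots> \<le> D\<^sup>2 + 2 * \<nu> * (- (norm_W W e)\<^sup>2 + \<eta> * D + \<eta>\<^sup>2) + \<nu>\<^sup>2 * (norm_W W e)\<^sup>2"
    using 2 \<nu> by (intro add_mono mult_left_mono order_refl) auto
  also have "\<dots> = D\<^sup>2 - \<nu> * (2 - \<nu>) * (norm_W W e)\<^sup>2 + 2 * \<nu> * (\<eta> * D + \<eta>\<^sup>2)"
    by (simp add: power2_eq_square algebra_simps)
  also have "\<dots> \<le> D\<^sup>2 - \<nu> * (2 - \<nu>) * (norm_W W e)\<^sup>2 + 2 * 2 * (\<eta> * D + \<eta>\<^sup>2)"
    using \<nu> D\<eta> by (intro add_mono mult_right_mono order_refl) auto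
  also have "\<dots> = (D + 2 * \<eta>)\<^sup>2 - \<nu> * (2 - \<nu>) * (norm_W W e)\<^sup>2"
    by (simp add: power2_eq_square algebra_simps)
  finally show "(norm_W W (s + t + \<nu> *\<^sub>R e))\<^sup>2 + \<nu> * (2 - \<nu>) * (norm_W W e)\<^sup>2
           \<le> (norm_W W (s + t) + 2 * norm_W W \<epsilon>)\<^sup>2"
    unfolding st(3) D_def \<eta>_def by simp
qed

text \<open>The recursion freed from \<open>f\<close> and \<open>g\<close>: \<open>e\<close> is the
  exact displacement, \<open>\<delta>\<close> its error, and \<open>\<epsilon>\<close> corrects the
  splitting of \<open>z + \<pi>\<close>. A solution enters only through \<open>M1\<close> and
  \<open>M2\<close> of \<open>fejer_convergence\<close>; \<open>ergodic_bounds\<close> works from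
  boundedness instead.\<close>

context
  fixes \<nu> :: "nat \<Rightarrow> real" and l h :: real and z \<pi> e \<epsilon> \<delta> :: "nat \<Rightarrow> real^'m"
  assumes \<nu>: "0 < l" "\<And>k. l \<le> \<nu> k" "\<And>k. \<nu> k \<le> h" "h < 2"
    and rec: "\<And>k. z (Suc k) + \<pi> (Suc k) = z k + \<pi> k + \<nu> k *\<^sub>R (e k + \<delta> k)"
    and \<epsilon>: "summable (\<lambda>k. norm_W W (\<epsilon> k))" and \<delta>: "summable (\<lambda>k. norm_W W (\<delta> k))"
begin

text \<open>The distances to a solution decrease up to summable errors, hence converge. The distance
  after an exact step is squeezed to the same limit, so the gain
  \<open>\<nu> k * (2 - \<nu> k) * (norm_W W (e k))\<^sup>2\<close> has to vanish.\<close>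

lemma fejer_convergence:
  assumes M1: "\<And>k. inner_W W (\<pi> k + e k - \<pi>') (z k + e k - z') \<le> 0"
    and M2: "\<And>k. 0 \<le> inner_W W (\<pi> k + \<epsilon> k - \<pi>') (z k - \<epsilon> k - z')"
  shows "convergent (\<lambda>k. norm_W W (z k + \<pi> k - (z' + \<pi>')))"
    and "(\<lambda>k. norm_W W (e k)) \<longlonglongrightarrow> 0"
    and "norm_W W (z k - \<epsilon> k - z') \<le> norm_W W (z k + \<pi> k - (z' + \<pi>'))"
proof -
  note nn = norm_W_nonneg[OF W]
  define D where "D k = norm_W W (z k + \<pi> k - (z' + \<pi>'))" for k
  define D' where "D' k = norm_W W (z k + \<pi> k - (z' + \<pi>') + \<nu> k *\<^sub>R e k)" for k
  have \<nu>02: "0 < \<nu> k" "\<nu> k < 2" for k using \<nu>(1,4) \<nu>(2,3)[of k] by linarith+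
  have eq: "z k - z' + (\<pi> k - \<pi>') = z k + \<pi> k - (z' + \<pi>')"
    "\<pi> k - \<pi>' + e k = \<pi> k + e k - \<pi>'" "z k - z' + e k = z k + e k - z'"
    "\<pi> k - \<pi>' + \<epsilon> k = \<pi> k + \<epsilon> k - \<pi>'" "z k - z' - \<epsilon> k = z k - \<epsilon> k - z'" for k
    by auto
  have step: "(D' k)\<^sup>2 + \<nu> k * (2 - \<nu> k) * (norm_W W (e k))\<^sup>2 \<le> (D k + 2 * norm_W W (\<epsilon> k))\<^sup>2"
    "norm_W W (z k - \<epsilon> k - z') \<le> D k" for k
    using fejer_step[of "\<pi> k - \<pi>'" "e k" "z k - z'" "\<epsilon> k" "\<nu> k"] M1[of k] M2[of k] \<nu>02[of k]
    unfolding eq D_def D'_def by auto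
  show "norm_W W (z k - \<epsilon> k - z') \<le> norm_W W (z k + \<pi> k - (z' + \<pi>'))"
    using step(2) by (simp add: D_def)
  have D'_le: "D' k \<le> D k + 2 * norm_W W (\<epsilon> k)" for k
  proof (rule power2_le_imp_le)
    have "0 \<le> \<nu> k * (2 - \<nu> k) * (norm_W W (e k))\<^sup>2" using \<nu>02[of k] by simp
    then show "(D' k)\<^sup>2 \<le> (D k + 2 * norm_W W (\<epsilon> k))\<^sup>2" using step(1)[of k] by linarith
  qed (simp add: D_def nn)
  have D_le: "D (Suc k) \<le> D' k + 2 * norm_W W (\<delta> k)" for k
  proof -
    have "D (Suc k) = norm_W W ((z k + \<pi> k - (z' + \<pi>') + \<nu> k *\<^sub>R e k) + \<nu> k *\<^sub>R \<delta> k)"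
      unfolding D_def rec by (simp add: algebra_simps)
    also have "\<dots> \<le> D' k + \<nu> k * norm_W W (\<delta> k)"
      using norm_W_triangle[OF W, of "z k + \<pi> k - (z' + \<pi>') + \<nu> k *\<^sub>R e k" "\<nu> k *\<^sub>R \<delta> k"] \<nu>02[of k]
      by (simp add: D'_def norm_W_scaleR[OF W])
    also have "\<dots> \<le> D' k + 2 * norm_W W (\<delta> k)"
      using \<nu>02[of k] nn by (intro add_left_mono mult_right_mono) auto
    finally show ?thesis .
  qed
  have "convergent D"
  proof (rule quasi_decreasing_convergent)
    show "D (Suc k) \<le> D k + (2 * norm_W W (\<epsilon> k) + 2 * norm_W W (\<delta> k))" for k
      using D'_le[of k] D_le[of k] by linarith
    show "summable (\<lambda>k. 2 * norm_W W (\<epsilon> k) + 2 * norm_W W (\<delta> k))"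
      by (intro summable_add summable_mult \<epsilon> \<delta>)
  qed (auto simp: D_def nn)
  then show "convergent (\<lambda>k. norm_W W (z k + \<pi> k - (z' + \<pi>')))" by (simp add: D_def[abs_def])
  from \<open>convergent D\<close> obtain d where d: "D \<longlonglongrightarrow> d" by (auto simp: convergent_def)
  have 1: "(\<lambda>k. D k + 2 * norm_W W (\<epsilon> k)) \<longlonglongrightarrow> d + 2 * 0"
    by (intro tendsto_intros d summable_LIMSEQ_zero \<epsilon>)
  have 2: "(\<lambda>k. D (Suc k) - 2 * norm_W W (\<delta> k)) \<longlonglongrightarrow> d - 2 * 0"
    by (intro tendsto_intros LIMSEQ_Suc d summable_LIMSEQ_zero \<delta>)
  have "D' \<longlonglongrightarrow> d"
  proof (rule tendsto_sandwich)
    show "eventually (\<lambda>k. D (Suc k) - 2 * norm_W W (\<delta> k) \<le> D' k) sequentially"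
      using D_le by (auto simp: diff_le_eq)
    show "eventually (\<lambda>k. D' k \<le> D k + 2 * norm_W W (\<epsilon> k)) sequentially"
      using D'_le by auto
  qed (use 1 2 in auto)
  then have "(\<lambda>k. ((D k + 2 * norm_W W (\<epsilon> k))\<^sup>2 - (D' k)\<^sup>2) / (l * (2 - h)))
      \<longlonglongrightarrow> ((d + 2 * 0)\<^sup>2 - d\<^sup>2) / (l * (2 - h))"
    using \<nu> by (intro tendsto_intros 1) auto
  then have "(\<lambda>k. ((D k + 2 * norm_W W (\<epsilon> k))\<^sup>2 - (D' k)\<^sup>2) / (l * (2 - h))) \<longlonglongrightarrow> 0"
    by simp
  then have "(\<lambda>k. (norm_W W (e k))\<^sup>2) \<longlonglongrightarrow> 0"
  proof (rule Lim_null_comparison[rotated], intro always_eventually allI)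
    fix k
    \<comment> \<open>The relaxation factors stay away from both \<open>0\<close> and
      \<open>2\<close>, so the vanishing gain forces \<open>e k\<close> itself to vanish.\<close>
    have "l * (2 - h) \<le> \<nu> k * (2 - \<nu> k)"
      using \<nu>(1,4) \<nu>(2,3)[of k] \<nu>02[of k] by (intro mult_mono) auto
    then have "l * (2 - h) * (norm_W W (e k))\<^sup>2 \<le> \<nu> k * (2 - \<nu> k) * (norm_W W (e k))\<^sup>2"
      by (rule mult_right_mono) simp
    with step(1)[of k]
    have "(norm_W W (e k))\<^sup>2 * (l * (2 - h)) \<le> (D k + 2 * norm_W W (\<epsilon> k))\<^sup>2 - (D' k)\<^sup>2"
      by (simp add: mult.commute)
    then show "norm ((norm_W W (e k))\<^sup>2)
        \<le> ((D k + 2 * norm_W W (\<epsilon> k))\<^sup>2 - (D' k)\<^sup>2) / (l * (2 - h))"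
      using \<nu> by (simp add: pos_le_divide_eq)
  qed
  then show "(\<lambda>k. norm_W W (e k)) \<longlonglongrightarrow> 0"
    using tendsto_real_sqrt[of "\<lambda>k. (norm_W W (e k))\<^sup>2" 0 sequentially] by (simp add: nn)
qed

text \<open>
  Since \<open>\<parallel>u + \<nu> e\<parallel>\<^sup>2 - \<parallel>u\<parallel>\<^sup>2 = 2 \<nu> \<langle>e, u\<rangle> + \<nu>\<^sup>2 \<parallel>e\<parallel>\<^sup>2\<close> with \<open>u = z + \<pi>\<close>, the sum telescopes up to
  nonnegative terms \<open>\<nu> (1 - \<nu> / 2) \<parallel>e\<parallel>\<^sup>2\<close> and summable errors.
\<close>

lemma ergodic_bounds:
  assumes U: "\<And>k. norm_W W (z k) \<le> U" "\<And>k. norm_W W (\<pi> k) \<le> U" "\<And>k. norm_W W (z k + \<pi> k) \<le> U"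
  obtains C where
    "\<And>N. - C \<le> (\<Sum>k<N. \<nu> k * (inner_W W (\<pi> k + e k) (z k + e k) - inner_W W (\<pi> k + \<epsilon> k) (z k - \<epsilon> k)))"
    "\<And>N. norm_W W (\<Sum>k<N. \<nu> k *\<^sub>R (e k + \<epsilon> k)) \<le> C"
    "\<And>N. norm_W W (\<Sum>k<N. \<nu> k *\<^sub>R (e k - \<epsilon> k)) \<le> C"
proof -
  note nn = norm_W_nonneg[OF W] and sq = norm_W_square[OF W] and comm = inner_W_commute[OF W]
  have \<nu>02: "0 < \<nu> k" "\<nu> k < 2" for k using \<nu>(1,4) \<nu>(2,3)[of k] by linarith+
  have U0: "0 \<le> U" using U(1)[of 0] nn[of "z 0"] by linarith
  define u where "u k = z k + \<pi> k" for k
  have u: "u (Suc k) = u k + \<nu> k *\<^sub>R (e k + \<delta> k)" for k using rec by (simp add: u_def)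
  have uU: "norm_W W (u k) \<le> U" for k using U(3) by (simp add: u_def)
  have S\<epsilon>: "(\<Sum>k<N. norm_W W (\<epsilon> k)) \<le> (\<Sum>k. norm_W W (\<epsilon> k))" for N
    by (rule sum_le_suminf) (auto simp: \<epsilon> nn)
  have S\<delta>: "(\<Sum>k<N. norm_W W (\<delta> k)) \<le> (\<Sum>k. norm_W W (\<delta> k))" for N
    by (rule sum_le_suminf) (auto simp: \<delta> nn)
  have pos: "0 \<le> (\<Sum>k. norm_W W (\<epsilon> k))" "0 \<le> (\<Sum>k. norm_W W (\<delta> k))"
    using S\<epsilon>[of 0] S\<delta>[of 0] by auto
  \<comment> \<open>Of the \<open>6 * U\<close>, a share \<open>2 * U\<close> pays for
    \<open>\<delta>\<close> against \<open>u\<close>, and \<open>4 * U\<close> for twice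
    \<open>\<delta>\<close> against \<open>E = e k + \<delta> k\<close>, where
    \<open>\<nu> k *\<^sub>R E\<close> is an increment of \<open>u\<close> and so has norm at most
    \<open>2 * U\<close>. The \<open>4 * U\<close> pays for \<open>\<epsilon>\<close> against
    \<open>z\<close> and \<open>\<pi>\<close>.\<close>
  have term_ge: "((norm_W W (u (Suc k)))\<^sup>2 - (norm_W W (u k))\<^sup>2) / 2
        - 6 * U * norm_W W (\<delta> k) - 4 * U * norm_W W (\<epsilon> k)
      \<le> \<nu> k * (inner_W W (\<pi> k + e k) (z k + e k) - inner_W W (\<pi> k + \<epsilon> k) (z k - \<epsilon> k))" for k
  proof -
    define E where "E = e k + \<delta> k"
    have e: "e k = E - \<delta> k" by (simp add: E_def)
    have expand: "inner_W W (\<pi> k + e k) (z k + e k) - inner_W W (\<pi> k + \<epsilon> k) (z k - \<epsilon> k)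
      = inner_W W E (u k) + (norm_W W E)\<^sup>2
        + ((norm_W W (\<delta> k))\<^sup>2 - inner_W W (\<delta> k) (u k) - 2 * inner_W W (\<delta> k) E)
        + ((norm_W W (\<epsilon> k))\<^sup>2 - inner_W W (\<epsilon> k) (z k) + inner_W W (\<epsilon> k) (\<pi> k))"
      unfolding u_def sq e
      by (simp add: inner_W_linear comm[of "\<pi> k" "\<delta> k"] comm[of "\<pi> k" E] comm[of "\<pi> k" "\<epsilon> k"]
          comm[of E "\<delta> k"])
    have n_E: "\<nu> k * norm_W W E \<le> 2 * U"
    proof -
      have "\<nu> k * norm_W W E = norm_W W (u (Suc k) - u k)"
        using \<nu>02[of k] by (simp add: u E_def[symmetric] norm_W_scaleR[OF W])
      also have "\<dots> \<le> norm_W W (u (Suc k)) + norm_W W (u k)"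
        by (rule norm_W_triangle_diff[OF W])
      finally show ?thesis using uU[of k] uU[of "Suc k"] by linarith
    qed
    have \<delta>_term: "- (6 * U * norm_W W (\<delta> k))
        \<le> \<nu> k * ((norm_W W (\<delta> k))\<^sup>2 - inner_W W (\<delta> k) (u k) - 2 * inner_W W (\<delta> k) E)"
    proof -
      have "inner_W W (\<delta> k) (u k) \<le> norm_W W (\<delta> k) * U"
        using inner_W_le_norm_W[OF W, of "\<delta> k" "u k"] mult_left_mono[OF uU nn] order_trans by blast
      then have "inner_W W (\<delta> k) (u k) + 2 * inner_W W (\<delta> k) E
          \<le> norm_W W (\<delta> k) * U + 2 * (norm_W W (\<delta> k) * norm_W W E)"
        using inner_W_le_norm_W[OF W, of "\<delta> k" E] by linarith
      then have "\<nu> k * (inner_W W (\<delta> k) (u k) + 2 * inner_W W (\<delta> k) E)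
          \<le> \<nu> k * (norm_W W (\<delta> k) * U + 2 * (norm_W W (\<delta> k) * norm_W W E))"
        using \<nu>02[of k] by (intro mult_left_mono) auto
      also have "\<dots> = \<nu> k * (norm_W W (\<delta> k) * U) + 2 * norm_W W (\<delta> k) * (\<nu> k * norm_W W E)"
        by (simp add: algebra_simps)
      also have "\<dots> \<le> 2 * (norm_W W (\<delta> k) * U) + 2 * norm_W W (\<delta> k) * (2 * U)"
      proof (rule add_mono)
        show "\<nu> k * (norm_W W (\<delta> k) * U) \<le> 2 * (norm_W W (\<delta> k) * U)"
          using \<nu>02[of k] nn U0 by (intro mult_right_mono) auto
        show "2 * norm_W W (\<delta> k) * (\<nu> k * norm_W W E) \<le> 2 * norm_W W (\<delta> k) * (2 * U)"
          by (rule mult_left_mono[OF n_E]) (simp add: nn)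
      qed
      finally have "\<nu> k * (inner_W W (\<delta> k) (u k) + 2 * inner_W W (\<delta> k) E)
          \<le> 6 * U * norm_W W (\<delta> k)" by (simp add: mult_ac)
      moreover have "0 \<le> \<nu> k * (norm_W W (\<delta> k))\<^sup>2" using \<nu>02[of k] by simp
      ultimately show ?thesis by (simp add: algebra_simps)
    qed
    have \<epsilon>_term: "- (4 * U * norm_W W (\<epsilon> k))
        \<le> \<nu> k * ((norm_W W (\<epsilon> k))\<^sup>2 - inner_W W (\<epsilon> k) (z k) + inner_W W (\<epsilon> k) (\<pi> k))"
    proof -
      have "inner_W W (\<epsilon> k) (z k) \<le> norm_W W (\<epsilon> k) * U"
        "- inner_W W (\<epsilon> k) (\<pi> k) \<le> norm_W W (\<epsilon> k) * U"
        using abs_inner_W_le[OF W, of "\<epsilon> k" "z k"] mult_left_mono[OF U(1) nn, of "\<epsilon> k" k]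
          abs_inner_W_le[OF W, of "\<epsilon> k" "\<pi> k"] mult_left_mono[OF U(2) nn, of "\<epsilon> k" k]
        by linarith+
      then have "\<nu> k * (inner_W W (\<epsilon> k) (z k) - inner_W W (\<epsilon> k) (\<pi> k))
          \<le> \<nu> k * (2 * (norm_W W (\<epsilon> k) * U))"
        using \<nu>02[of k] by (intro mult_left_mono) auto
      also have "\<dots> \<le> 2 * (2 * (norm_W W (\<epsilon> k) * U))"
        using \<nu>02[of k] nn U0 by (intro mult_right_mono) auto
      finally have "\<nu> k * (inner_W W (\<epsilon> k) (z k) - inner_W W (\<epsilon> k) (\<pi> k))
          \<le> 4 * U * norm_W W (\<epsilon> k)" by (simp add: mult_ac)
      moreover have "0 \<le> \<nu> k * (norm_W W (\<epsilon> k))\<^sup>2" using \<nu>02[of k] by simp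
      ultimately show ?thesis by (simp add: algebra_simps)
    qed
    have "(norm_W W (u (Suc k)))\<^sup>2
        = (norm_W W (u k))\<^sup>2 + 2 * \<nu> k * inner_W W E (u k) + (\<nu> k)\<^sup>2 * (norm_W W E)\<^sup>2"
      unfolding u sq E_def[symmetric]
      by (simp add: inner_W_linear comm[of "u k" E] power2_eq_square algebra_simps)
    moreover have "0 \<le> \<nu> k * (2 - \<nu> k) * (norm_W W E)\<^sup>2" using \<nu>02[of k] by simp
    ultimately have "((norm_W W (u (Suc k)))\<^sup>2 - (norm_W W (u k))\<^sup>2) / 2
        \<le> \<nu> k * (inner_W W E (u k) + (norm_W W E)\<^sup>2)"
      by (simp add: power2_eq_square algebra_simps)
    then show ?thesis
      using \<delta>_term \<epsilon>_term unfolding expand distrib_left by linarith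
  qed
  \<comment> \<open>One constant for all three bounds: the first line serves the telescoped sum, the
    second the two vector sums.\<close>
  define C where "C = U\<^sup>2 + 6 * U * (\<Sum>k. norm_W W (\<delta> k)) + 4 * U * (\<Sum>k. norm_W W (\<epsilon> k))
      + (2 * U + 2 * (\<Sum>k. norm_W W (\<delta> k)) + 2 * (\<Sum>k. norm_W W (\<epsilon> k)))"
  have C_parts: "0 \<le> U\<^sup>2" "0 \<le> 6 * U * (\<Sum>k. norm_W W (\<delta> k))" "0 \<le> 4 * U * (\<Sum>k. norm_W W (\<epsilon> k))"
    using U0 pos by auto
  have C_ge: "2 * U + 2 * (\<Sum>k. norm_W W (\<delta> k)) + 2 * (\<Sum>k. norm_W W (\<epsilon> k)) \<le> C"
    unfolding C_def by (intro add_increasing add_nonneg_nonneg order_refl C_parts)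
  have sum_norm: "norm_W W (\<Sum>k<N. w k) \<le> (\<Sum>k<N. norm_W W (w k))" for w :: "nat \<Rightarrow> real^'m" and N
  proof (induction N)
    case (Suc N)
    then show ?case using norm_W_triangle[OF W, of "\<Sum>k<N. w k" "w N"] by simp
  qed (simp add: norm_W_def)
  have sum_scaled: "norm_W W (\<Sum>k<N. \<nu> k *\<^sub>R w k) \<le> 2 * (\<Sum>k<N. norm_W W (w k))"
    for w :: "nat \<Rightarrow> real^'m" and N
    unfolding sum_distrib_left
    by (rule order_trans[OF sum_norm], rule sum_mono)
       (use \<nu>02 nn in \<open>auto simp: norm_W_scaleR[OF W] less_imp_le intro!: mult_right_mono\<close>)
  have sum_e: "(\<Sum>k<N. \<nu> k *\<^sub>R e k) = (u N - u 0) - (\<Sum>k<N. \<nu> k *\<^sub>R \<delta> k)" for N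
  proof (induction N)
    case (Suc N)
    then show ?case by (simp add: u algebra_simps)
  qed simp
  have e_bd: "norm_W W (\<Sum>k<N. \<nu> k *\<^sub>R e k) \<le> 2 * U + 2 * (\<Sum>k. norm_W W (\<delta> k))" for N
    using norm_W_triangle_diff[OF W, of "u N - u 0" "\<Sum>k<N. \<nu> k *\<^sub>R \<delta> k"]
      norm_W_triangle_diff[OF W, of "u N" "u 0"] uU[of N] uU[of 0]
      sum_scaled[of \<delta> N] S\<delta>[of N]
    unfolding sum_e by linarith
  have \<epsilon>_bd: "norm_W W (\<Sum>k<N. \<nu> k *\<^sub>R \<epsilon> k) \<le> 2 * (\<Sum>k. norm_W W (\<epsilon> k))" for N
    using sum_scaled[of \<epsilon> N] S\<epsilon>[of N] by linarith
  show thesis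
  proof
    fix N
    have "- C \<le> ((norm_W W (u N))\<^sup>2 - (norm_W W (u 0))\<^sup>2) / 2
        - 6 * U * (\<Sum>k<N. norm_W W (\<delta> k)) - 4 * U * (\<Sum>k<N. norm_W W (\<epsilon> k))"
    proof -
      have 1: "(norm_W W (u 0))\<^sup>2 \<le> U\<^sup>2" using uU nn by (rule power_mono)
      have 2: "0 \<le> (norm_W W (u N))\<^sup>2" by simp
      have aux: "- s \<le> (t - t') / 2" if "t' \<le> s" "0 \<le> t" "0 \<le> s" for s t t' :: real
        using that by simp
      have "- U\<^sup>2 \<le> ((norm_W W (u N))\<^sup>2 - (norm_W W (u 0))\<^sup>2) / 2"
        using 1 2 C_parts(1) by (rule aux)
      moreover have "6 * U * (\<Sum>k<N. norm_W W (\<delta> k)) \<le> 6 * U * (\<Sum>k. norm_W W (\<delta> k))"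
        "4 * U * (\<Sum>k<N. norm_W W (\<epsilon> k)) \<le> 4 * U * (\<Sum>k. norm_W W (\<epsilon> k))"
        using S\<epsilon> S\<delta> U0 by (auto intro!: mult_left_mono)
      ultimately have "- U\<^sup>2 - 6 * U * (\<Sum>k. norm_W W (\<delta> k)) - 4 * U * (\<Sum>k. norm_W W (\<epsilon> k))
          \<le> ((norm_W W (u N))\<^sup>2 - (norm_W W (u 0))\<^sup>2) / 2
            - 6 * U * (\<Sum>k<N. norm_W W (\<delta> k)) - 4 * U * (\<Sum>k<N. norm_W W (\<epsilon> k))"
        by (intro diff_mono)
      then show ?thesis unfolding C_def using U0 pos by simp
    qed
    also have "\<dots> = (\<Sum>k<N. ((norm_W W (u (Suc k)))\<^sup>2 - (norm_W W (u k))\<^sup>2) / 2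
        - 6 * U * norm_W W (\<delta> k) - 4 * U * norm_W W (\<epsilon> k))"
      unfolding sum_lessThan_telescope[of "\<lambda>k. (norm_W W (u k))\<^sup>2" N, symmetric]
      by (simp add: sum_subtractf sum_distrib_left sum_divide_distrib diff_divide_distrib)
    also have "\<dots> \<le> (\<Sum>k<N. \<nu> k * (inner_W W (\<pi> k + e k) (z k + e k) - inner_W W (\<pi> k + \<epsilon> k) (z k - \<epsilon> k)))"
      by (rule sum_mono) (rule term_ge)
    finally show "- C \<le> \<dots>" .
    show "norm_W W (\<Sum>k<N. \<nu> k *\<^sub>R (e k + \<epsilon> k)) \<le> C"
      using norm_W_triangle[OF W, of "\<Sum>k<N. \<nu> k *\<^sub>R e k" "\<Sum>k<N. \<nu> k *\<^sub>R \<epsilon> k"] e_bd[of N] \<epsilon>_bd[of N]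
        C_ge by (simp add: scaleR_add_right sum.distrib)
    show "norm_W W (\<Sum>k<N. \<nu> k *\<^sub>R (e k - \<epsilon> k)) \<le> C"
      using norm_W_triangle_diff[OF W, of "\<Sum>k<N. \<nu> k *\<^sub>R e k" "\<Sum>k<N. \<nu> k *\<^sub>R \<epsilon> k"] e_bd[of N] \<epsilon>_bd[of N]
        C_ge by (simp add: scaleR_diff_right sum_subtractf)
  qed
qed

end

end

section \<open>Inexact ADMM\<close>

text \<open>Here \<open>X k\<close> and \<open>Z k\<close> are the exact minimizers that \<open>x k\<close> and \<open>z k\<close> approximate.\<close>

locale inexact_admm =
  fixes f :: "real^'n \<Rightarrow> ereal" and g :: "real^'m \<Rightarrow> ereal"
    and M :: "real^'n^'m" and W :: "real^'m^'m"
    and c l h :: real and \<nu> \<tau> a b :: "nat \<Rightarrow> real"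
    and z p Z :: "nat \<Rightarrow> real^'m" and x X :: "nat \<Rightarrow> real^'n"
  assumes f: "closed_proper_convex f" and g: "closed_proper_convex g"
    and W: "symmetric_positive_definite W" and c: "c > 0"
    and \<nu>: "0 < l" "\<And>k. l \<le> \<nu> k" "\<And>k. \<nu> k \<le> h" "h < 2"
    and fX: "\<And>k. f (X k) = ereal (a k)"
    and X_le: "\<And>k y. ereal (a k + (p k + c *\<^sub>R (W *v (M *v X k - z k))) \<bullet> (M *v X k - M *v y)) \<le> f y"
    and X_err: "summable (\<lambda>k. norm_W W (M *v x k - M *v X k))"
    and fx: "\<And>k. f (x k) \<le> ereal (a k + p k \<bullet> (M *v X k - M *v x k)
        + c / 2 * (norm_W W (M *v X k - z k))\<^sup>2 - c / 2 * (norm_W W (M *v x k - z k))\<^sup>2 + \<tau> k)"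
    and \<tau>: "\<tau> \<longlonglongrightarrow> 0"
    and gZ: "\<And>k. g (Z k) = ereal (b k)"
    and Z_le: "\<And>k v. ereal (b k + (p k + c *\<^sub>R (W *v (z k - Z k))) \<bullet> (v - Z k)) \<le> g v"
    and Z_err: "summable (\<lambda>k. norm_W W (z k - Z k))"
    and step: "\<And>k. p (Suc k) + c *\<^sub>R (W *v z (Suc k)) =
        p k + c *\<^sub>R (W *v (\<nu> k *\<^sub>R (M *v x k) + (1 - \<nu> k) *\<^sub>R z k))"
begin

section \<open>Reformulation of the iteration as a perturbed relaxation recursion\<close>

definition scaled_dual :: "real^'m \<Rightarrow> real^'m"
  where "scaled_dual q = (1 / c) *\<^sub>R (matrix_inv W *v q)"

lemma scaled_dual: "c *\<^sub>R (W *v scaled_dual q) = q"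
  using c by (simp add: scaled_dual_def matrix_vector_mult_scaleR matrix_inv_spd[OF W])

lemma scaled_dual_unique: "c *\<^sub>R (W *v v) = q \<Longrightarrow> scaled_dual q = v"
  using c by (auto simp: scaled_dual_def matrix_vector_mult_scaleR matrix_inv_spd[OF W])

lemma inner_scaled: "(c *\<^sub>R (W *v v)) \<bullet> w = c * inner_W W v w"
  unfolding inner_W_commute[OF W, of v w] by (simp add: inner_W_def inner_commute)

definition \<pi> where "\<pi> k = scaled_dual (p k)"
definition e where "e k = M *v X k - z k"
definition \<delta> where "\<delta> k = M *v x k - M *v X k"
definition \<epsilon> where "\<epsilon> k = z k - Z k"
text \<open>The exact optimality certificates: \<open>- (transpose M *v r k)\<close> is a
  subgradient of \<open>f\<close> at \<open>X k\<close>, and \<open>P k\<close> is one of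
  \<open>g\<close> at \<open>Z k\<close>.\<close>

definition r where "r k = p k + c *\<^sub>R (W *v e k)"
definition P where "P k = p k + c *\<^sub>R (W *v \<epsilon> k)"

lemma p_eq: "p k = c *\<^sub>R (W *v \<pi> k)" by (simp add: \<pi>_def scaled_dual)

lemma r_eq: "r k = c *\<^sub>R (W *v (\<pi> k + e k))"
  by (simp add: r_def p_eq matrix_vector_right_distrib scaleR_add_right)

lemma P_eq: "P k = c *\<^sub>R (W *v (\<pi> k + \<epsilon> k))"
  by (simp add: P_def p_eq matrix_vector_right_distrib scaleR_add_right)

lemma MX_eq: "M *v X k = z k + e k" by (simp add: e_def)
lemma Z_eq: "Z k = z k - \<epsilon> k" by (simp add: \<epsilon>_def)

text \<open>By the multiplier update, \<open>p + c *\<^sub>R (W *v z)\<close> depends only on the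
  relaxed point, so the error \<open>\<epsilon>\<close> of the \<open>z\<close>-step cancels and
  only \<open>\<delta>\<close> perturbs the recursion.\<close>

lemma recursion: "z (Suc k) + \<pi> (Suc k) = z k + \<pi> k + \<nu> k *\<^sub>R (e k + \<delta> k)"
proof -
  have add: "c *\<^sub>R (W *v (v + w)) = c *\<^sub>R (W *v v) + c *\<^sub>R (W *v w)" for v w
    by (simp add: matrix_vector_right_distrib scaleR_add_right)
  have "c *\<^sub>R (W *v (\<pi> (Suc k) + z (Suc k)))
      = c *\<^sub>R (W *v (\<pi> k + (\<nu> k *\<^sub>R (M *v x k) + (1 - \<nu> k) *\<^sub>R z k)))"
    unfolding add[of "\<pi> (Suc k)"] add[of "\<pi> k"] p_eq[symmetric] by (rule step)
  from scaled_dual_unique[OF this]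
  have "\<pi> (Suc k) + z (Suc k) = \<pi> k + (\<nu> k *\<^sub>R (M *v x k) + (1 - \<nu> k) *\<^sub>R z k)"
    unfolding scaled_dual_unique[OF refl] by simp
  then show ?thesis by (simp add: e_def \<delta>_def algebra_simps)
qed

lemma \<epsilon>_summable: "summable (\<lambda>k. norm_W W (\<epsilon> k))" using Z_err by (simp add: \<epsilon>_def)
lemma \<delta>_summable: "summable (\<lambda>k. norm_W W (\<delta> k))" using X_err by (simp add: \<delta>_def)

lemma \<epsilon>_lim: "\<epsilon> \<longlonglongrightarrow> 0"
  using summable_LIMSEQ_zero[OF \<epsilon>_summable] tendsto_norm_W_iff[OF W, of \<epsilon> 0] by simp
lemma \<delta>_lim: "\<delta> \<longlonglongrightarrow> 0"
  using summable_LIMSEQ_zero[OF \<delta>_summable] tendsto_norm_W_iff[OF W, of \<delta> 0] by simp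

lemma a_le:
  assumes "f y = ereal s" shows "a k + r k \<bullet> (M *v X k - M *v y) \<le> s"
  using X_le[of k y] assms by (simp add: r_def e_def)

lemma b_le:
  assumes "g v = ereal s" shows "b k + P k \<bullet> (v - Z k) \<le> s"
  using Z_le[of k v] assms by (simp add: P_def \<epsilon>_def)

lemma f_real: "f y \<noteq> \<infinity> \<Longrightarrow> \<exists>s. f y = ereal s" and g_real: "g v \<noteq> \<infinity> \<Longrightarrow> \<exists>s. g v = ereal s"
  using f g by (cases "f y", auto simp: closed_proper_convex_def proper_def)
    (cases "g v", auto)

text \<open>Monotonicity of the two subdifferentials. Since \<open>z'\<close> may lie outside the
  range of \<open>M\<close>, the inequality for \<open>f\<close> is tested in the dual space, at the
  multiplier \<open>r k\<close>; the subgradients there are \<open>- z'\<close> and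
  \<open>- (M *v X k)\<close>, whence the reversed sign.\<close>

lemma monotone:
  assumes "splitting_solution f g M z' p'"
  shows "inner_W W (\<pi> k + e k - scaled_dual p') (z k + e k - z') \<le> 0"
    and "0 \<le> inner_W W (\<pi> k + \<epsilon> k - scaled_dual p') (z k - \<epsilon> k - z')"
proof -
  obtain b' \<alpha> where b': "g z' = ereal b'" "\<And>v. ereal (b' + p' \<bullet> (v - z')) \<le> g v"
    and \<alpha>: "\<And>x. ereal (\<alpha> - p' \<bullet> (M *v x)) \<le> f x"
      "\<And>q. ereal (- \<alpha> - z' \<bullet> (q - p')) \<le> conjugate f (- (transpose M *v q))"
    using assms unfolding splitting_solution_def by blast
  have diff: "c * inner_W W (v - scaled_dual p') w = (c *\<^sub>R (W *v v) - p') \<bullet> w" for v w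
    unfolding inner_scaled[symmetric]
    by (simp add: matrix_vector_mult_diff_distrib scaleR_diff_right scaled_dual)
  have "conjugate f (- (transpose M *v r k)) \<le> ereal (- (a k + r k \<bullet> (M *v X k)))"
  proof (rule conjugate_transpose_le)
    fix y show "ereal (a k + r k \<bullet> (M *v X k) - r k \<bullet> (M *v y)) \<le> f y"
      using X_le[of k y] by (simp add: r_def e_def inner_diff_right add_diff_eq)
  qed
  with \<alpha>(2)[of "r k"] have "- \<alpha> - z' \<bullet> (r k - p') \<le> - (a k + r k \<bullet> (M *v X k))"
    using order_trans ereal_less_eq(3) by blast
  moreover have "\<alpha> - p' \<bullet> (M *v X k) \<le> a k" using \<alpha>(1)[of "X k"] by (simp add: fX)
  ultimately have "(r k - p') \<bullet> (M *v X k - z') \<le> 0"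
    by (simp add: inner_simps inner_commute)
  then have "c * inner_W W (\<pi> k + e k - scaled_dual p') (z k + e k - z') \<le> 0"
    unfolding diff r_eq MX_eq .
  then show "inner_W W (\<pi> k + e k - scaled_dual p') (z k + e k - z') \<le> 0"
    using c by (simp add: mult_le_0_iff)
  have "b k + P k \<bullet> (z' - Z k) \<le> b'" "b' + p' \<bullet> (Z k - z') \<le> b k"
    using b_le[OF b'(1)] b'(2)[of "Z k"] by (auto simp: gZ)
  then have "0 \<le> (P k - p') \<bullet> (Z k - z')" by (simp add: inner_simps)
  then have "0 \<le> c * inner_W W (\<pi> k + \<epsilon> k - scaled_dual p') (z k - \<epsilon> k - z')"
    unfolding diff P_eq[symmetric] Z_eq[symmetric] .
  then show "0 \<le> inner_W W (\<pi> k + \<epsilon> k - scaled_dual p') (z k - \<epsilon> k - z')"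
    using c by (simp add: zero_le_mult_iff)
qed

lemma tendsto_matrix: "v \<longlonglongrightarrow> v' \<Longrightarrow> (\<lambda>k. (A :: real^'i^'j) *v v k) \<longlonglongrightarrow> A *v v'"
  by (rule bounded_linear.tendsto[OF matrix_vector_mul_bounded_linear])

text \<open>A closed-graph argument: the inequalities certified by \<open>r k\<close> and
  \<open>P k\<close> pass to the limit along the subsequence, on the \<open>g\<close>-side by lower
  semicontinuity.\<close>

lemma cluster_point_solution:
  assumes k: "strict_mono \<phi>" and lim: "(z \<circ> \<phi>) \<longlonglongrightarrow> z'" "(p \<circ> \<phi>) \<longlonglongrightarrow> p'" and e0: "e \<longlonglongrightarrow> 0"
  shows "splitting_solution f g M z' p'"
proof -
  have sub: "(\<lambda>k. s (\<phi> k)) \<longlonglongrightarrow> 0" if "s \<longlonglongrightarrow> 0" for s :: "nat \<Rightarrow> real^'m"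
    using LIMSEQ_subseq_LIMSEQ[OF that k] by (simp add: o_def)
  have z_lim: "(\<lambda>k. z (\<phi> k)) \<longlonglongrightarrow> z'" and p_lim: "(\<lambda>k. p (\<phi> k)) \<longlonglongrightarrow> p'"
    using lim by (simp_all add: o_def)
  have MX_lim: "(\<lambda>k. M *v X (\<phi> k)) \<longlonglongrightarrow> z'"
    using tendsto_add[OF z_lim sub[OF e0]] by (simp add: MX_eq)
  have Z_lim: "(\<lambda>k. Z (\<phi> k)) \<longlonglongrightarrow> z'"
    using tendsto_diff[OF z_lim sub[OF \<epsilon>_lim]] by (simp add: Z_eq[symmetric])
  have r_lim: "(\<lambda>k. r (\<phi> k)) \<longlonglongrightarrow> p'"
    using tendsto_add[OF p_lim tendsto_scaleR[OF tendsto_const[of c] tendsto_matrix[OF sub[OF e0], of W]]]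
    by (simp add: r_def)
  have P_lim: "(\<lambda>k. P (\<phi> k)) \<longlonglongrightarrow> p'"
    using tendsto_add[OF p_lim tendsto_scaleR[OF tendsto_const[of c] tendsto_matrix[OF sub[OF \<epsilon>_lim], of W]]]
    by (simp add: P_def)
  have g_le: "g z' \<le> ereal (s - p' \<bullet> (v - z'))" if "g v = ereal s" for v s
  proof (rule closed_epigraph_limit[OF _ Z_lim])
    show "closed (ereal_epigraph g)" using g by (simp add: closed_proper_convex_def)
    show "(\<lambda>k. s - P (\<phi> k) \<bullet> (v - Z (\<phi> k))) \<longlonglongrightarrow> s - p' \<bullet> (v - z')"
      by (intro tendsto_intros P_lim Z_lim)
    show "eventually (\<lambda>k. g (Z (\<phi> k)) \<le> ereal (s - P (\<phi> k) \<bullet> (v - Z (\<phi> k)))) sequentially"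
      using b_le[OF that] by (simp add: gZ le_diff_eq)
  qed
  have "g z' \<noteq> \<infinity>" using g_le[OF gZ[of 0]] by auto
  then obtain b' where b': "g z' = ereal b'" using g_real by blast
  have g_sub: "ereal (b' + p' \<bullet> (v - z')) \<le> g v" for v
  proof (cases "g v = \<infinity>")
    case False
    then obtain s where "g v = ereal s" using g_real by blast
    then show ?thesis using g_le[of v s] b' by simp
  qed simp
  \<comment> \<open>Neither \<open>X k\<close> nor \<open>a k\<close> is known to converge. Fixing
    \<open>y\<close> and \<open>q\<close> and eliminating \<open>a k\<close> leaves only
    \<open>M *v X k\<close> and \<open>r k\<close>, which do.\<close>
  have f_ge: "- (z' \<bullet> (q - p')) - (s + p' \<bullet> (M *v y)) \<le> K"
    if s: "f y = ereal s" and K: "conjugate f (- (transpose M *v q)) = ereal K" for y s q K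
  proof (rule tendsto_upperbound)
    show "(\<lambda>k. - (q \<bullet> (M *v X (\<phi> k))) - (s + r (\<phi> k) \<bullet> (M *v y - M *v X (\<phi> k))))
        \<longlonglongrightarrow> - (z' \<bullet> (q - p')) - (s + p' \<bullet> (M *v y))"
    proof -
      have "(\<lambda>k. - (q \<bullet> (M *v X (\<phi> k))) - (s + r (\<phi> k) \<bullet> (M *v y - M *v X (\<phi> k))))
        \<longlonglongrightarrow> - (q \<bullet> z') - (s + p' \<bullet> (M *v y - z'))"
        by (intro tendsto_intros r_lim MX_lim)
      then show ?thesis by (simp add: inner_simps inner_commute algebra_simps)
    qed
    show "eventually (\<lambda>k. - (q \<bullet> (M *v X (\<phi> k)))
        - (s + r (\<phi> k) \<bullet> (M *v y - M *v X (\<phi> k))) \<le> K) sequentially"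
    proof (intro always_eventually allI)
      fix k
      have "- (q \<bullet> (M *v X (\<phi> k))) - a (\<phi> k) \<le> K"
        using conjugate_transpose_ge[of f "X (\<phi> k)" "a (\<phi> k)" q M] fX K by simp
      then show "- (q \<bullet> (M *v X (\<phi> k))) - (s + r (\<phi> k) \<bullet> (M *v y - M *v X (\<phi> k))) \<le> K"
        using a_le[OF s, of "\<phi> k"] by (simp add: inner_simps)
    qed
  qed simp
  \<comment> \<open>\<open>Inf S\<close> becomes the number \<open>\<alpha>\<close> of
    \<open>splitting_solution\<close>. A lower bound for \<open>S\<close> needs one multiplier with
    a finite conjugate value, and \<open>r 0\<close> supplies it.\<close>
  define S where "S = {s + p' \<bullet> (M *v y) | s y. f y = ereal s}"
  have S_ne: "S \<noteq> {}" using fX by (auto simp: S_def)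
  have S_low: "- (z' \<bullet> (q - p')) - K \<le> s"
    if "conjugate f (- (transpose M *v q)) = ereal K" "s \<in> S" for q K s
    using f_ge[OF _ that(1)] that(2) by (fastforce simp: S_def)
  have conj_ninf: "conjugate f q \<noteq> - \<infinity>" for q
    using f by (intro conjugate_proper_not_MInf) (simp add: closed_proper_convex_def)
  have "bdd_below S"
  proof -
    have "conjugate f (- (transpose M *v r 0)) \<le> ereal (- (a 0 + r 0 \<bullet> (M *v X 0)))"
    proof (rule conjugate_transpose_le)
      fix y show "ereal (a 0 + r 0 \<bullet> (M *v X 0) - r 0 \<bullet> (M *v y)) \<le> f y"
        using X_le[of 0 y] by (simp add: r_def e_def inner_diff_right add_diff_eq)
    qed
    then obtain K where "conjugate f (- (transpose M *v r 0)) = ereal K"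
      using conj_ninf by (cases "conjugate f (- (transpose M *v r 0))") auto
    then show ?thesis using S_low by (meson bdd_belowI)
  qed
  have "ereal (Inf S - p' \<bullet> (M *v y)) \<le> f y" for y
  proof (cases "f y = \<infinity>")
    case False
    then obtain s where s: "f y = ereal s" using f_real by blast
    then have "s + p' \<bullet> (M *v y) \<in> S" by (auto simp: S_def)
    then have "Inf S \<le> s + p' \<bullet> (M *v y)" using \<open>bdd_below S\<close> by (rule cInf_lower)
    then show ?thesis by (simp add: s)
  qed simp
  moreover have "ereal (- Inf S - z' \<bullet> (q - p')) \<le> conjugate f (- (transpose M *v q))" for q
  proof (cases "conjugate f (- (transpose M *v q))")
    case (real K)
    then have "- (z' \<bullet> (q - p')) - K \<le> Inf S" using S_ne S_low by (intro cInf_greatest) auto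
    then show ?thesis by (simp add: real)
  qed (use conj_ninf in auto)
  ultimately show ?thesis unfolding splitting_solution_def using b' g_sub by blast
qed

lemma fejer:
  assumes "splitting_solution f g M z' p'"
  shows "convergent (\<lambda>k. norm_W W (z k + \<pi> k - (z' + scaled_dual p')))"
    and "e \<longlonglongrightarrow> 0"
    and "norm_W W (Z k - z') \<le> norm_W W (z k + \<pi> k - (z' + scaled_dual p'))"
proof -
  note * = fejer_convergence[where \<pi>' = "scaled_dual p'" and z' = z', OF W \<nu>(1) \<nu>(2) \<nu>(3) \<nu>(4)
      recursion \<epsilon>_summable \<delta>_summable monotone[OF assms]]
  show "convergent (\<lambda>k. norm_W W (z k + \<pi> k - (z' + scaled_dual p')))" by (rule *(1))
  show "e \<longlonglongrightarrow> 0" using *(2) tendsto_norm_W_iff[OF W, of e 0] by simp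
  show "norm_W W (Z k - z') \<le> norm_W W (z k + \<pi> k - (z' + scaled_dual p'))"
    using *(3) unfolding Z_eq[symmetric] .
qed

lemma bounded_translate: "bounded (range (\<lambda>k. v k - w)) \<Longrightarrow> bounded (range v)"
  for v :: "nat \<Rightarrow> real^'i"
proof -
  assume "bounded (range (\<lambda>k. v k - w))"
  then obtain B where "\<And>k. norm (v k - w) \<le> B" by (auto simp: bounded_iff)
  then have "norm (v k) \<le> B + norm w" for k
    using norm_triangle_sub[of "v k" w] by (smt (verit))
  then show ?thesis by (auto simp: bounded_iff)
qed

text \<open>Opial's argument: a cluster point is a solution, the distance to it converges, and it
  tends to zero along a subsequence, hence along the whole sequence. The third part of
  \<open>fejer\<close> bounds \<open>Z\<close> separately from the sum \<open>z k + \<pi> k\<close>,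
  and at the end splits the limit of that sum.\<close>

lemma convergence:
  assumes sol: "splitting_solution f g M z0 p0"
  obtains z' p' where "splitting_solution f g M z' p'" "z \<longlonglongrightarrow> z'" "p \<longlonglongrightarrow> p'"
    "(\<lambda>k. M *v X k) \<longlonglongrightarrow> z'" "(\<lambda>k. M *v x k) \<longlonglongrightarrow> z'"
proof -
  note F = fejer[OF sol]
  obtain B where B: "\<And>k. norm_W W (z k + \<pi> k - (z0 + scaled_dual p0)) \<le> B"
    using convergent_imp_Bseq[OF F(1)] by (auto simp: Bseq_def dest: abs_le_D1)
  then have "bounded (range (\<lambda>k. z k + \<pi> k - (z0 + scaled_dual p0)))"
    using bounded_norm_W_iff[OF W, of "\<lambda>k. z k + \<pi> k - (z0 + scaled_dual p0)"] by blast
  then have "bounded (range (\<lambda>k. z k + \<pi> k))" by (rule bounded_translate)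
  moreover have "bounded (range (\<lambda>k. Z k - z0))"
    using bounded_norm_W_iff[OF W, of "\<lambda>k. Z k - z0"] B F(3) order_trans by blast
  then have "bounded (range Z)" by (rule bounded_translate)
  ultimately have "bounded (range Z \<times> range (\<lambda>k. z k + \<pi> k))" by (intro bounded_Times)
  then have "bounded (range (\<lambda>k. (Z k, z k + \<pi> k)))" by (rule bounded_subset) auto
  then obtain s \<phi> where \<phi>: "strict_mono \<phi>" "((\<lambda>k. (Z k, z k + \<pi> k)) \<circ> \<phi>) \<longlonglongrightarrow> s"
    using bounded_imp_convergent_subsequence by blast
  define z' \<pi>' p' where "z' = fst s" and "\<pi>' = snd s - fst s" and "p' = c *\<^sub>R (W *v \<pi>')"
  have \<epsilon>\<phi>: "(\<lambda>k. \<epsilon> (\<phi> k)) \<longlonglongrightarrow> 0" using LIMSEQ_subseq_LIMSEQ[OF \<epsilon>_lim \<phi>(1)] by (simp add: o_def)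
  have Z\<phi>: "(\<lambda>k. Z (\<phi> k)) \<longlonglongrightarrow> z'" using tendsto_fst[OF \<phi>(2)] by (simp add: o_def z'_def)
  have u\<phi>: "(\<lambda>k. z (\<phi> k) + \<pi> (\<phi> k)) \<longlonglongrightarrow> z' + \<pi>'"
    using tendsto_snd[OF \<phi>(2)] by (simp add: o_def z'_def \<pi>'_def)
  have z\<phi>: "(\<lambda>k. z (\<phi> k)) \<longlonglongrightarrow> z'" using tendsto_add[OF Z\<phi> \<epsilon>\<phi>] by (simp add: \<epsilon>_def)
  have \<pi>\<phi>: "(\<lambda>k. \<pi> (\<phi> k)) \<longlonglongrightarrow> \<pi>'" using tendsto_diff[OF u\<phi> z\<phi>] by simp
  have p\<phi>: "(\<lambda>k. p (\<phi> k)) \<longlonglongrightarrow> p'"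
    using tendsto_scaleR[OF tendsto_const[of c] tendsto_matrix[OF \<pi>\<phi>, of W]]
    unfolding p'_def p_eq[symmetric] .
  have sol': "splitting_solution f g M z' p'"
    using z\<phi> p\<phi> by (intro cluster_point_solution[OF \<phi>(1) _ _ F(2)]) (simp_all add: o_def)
  have sd: "scaled_dual p' = \<pi>'" by (rule scaled_dual_unique) (simp add: p'_def)
  note F' = fejer[OF sol', unfolded sd]
  obtain d where d: "(\<lambda>k. norm_W W (z k + \<pi> k - (z' + \<pi>'))) \<longlonglongrightarrow> d"
    using F'(1) by (auto simp: convergent_def)
  have "(\<lambda>k. norm_W W (z (\<phi> k) + \<pi> (\<phi> k) - (z' + \<pi>'))) \<longlonglongrightarrow> d"
    using LIMSEQ_subseq_LIMSEQ[OF d \<phi>(1)] by (simp add: o_def)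
  moreover have "(\<lambda>k. norm_W W (z (\<phi> k) + \<pi> (\<phi> k) - (z' + \<pi>'))) \<longlonglongrightarrow> 0"
    using u\<phi> tendsto_norm_W_iff[OF W, of "\<lambda>k. z (\<phi> k) + \<pi> (\<phi> k)" "z' + \<pi>'"] by simp
  ultimately have "d = 0" by (rule LIMSEQ_unique)
  with d have d0: "(\<lambda>k. norm_W W (z k + \<pi> k - (z' + \<pi>'))) \<longlonglongrightarrow> 0" by simp
  then have u: "(\<lambda>k. z k + \<pi> k) \<longlonglongrightarrow> z' + \<pi>'"
    using tendsto_norm_W_iff[OF W, of "\<lambda>k. z k + \<pi> k" "z' + \<pi>'"] by simp
  have "(\<lambda>k. norm_W W (Z k - z')) \<longlonglongrightarrow> 0"
    by (rule Lim_null_comparison[OF _ d0]) (simp add: F'(3) norm_W_nonneg[OF W])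
  then have Z: "Z \<longlonglongrightarrow> z'" using tendsto_norm_W_iff[OF W] by blast
  have z: "z \<longlonglongrightarrow> z'" using tendsto_add[OF Z \<epsilon>_lim] by (simp add: \<epsilon>_def)
  have \<pi>: "\<pi> \<longlonglongrightarrow> \<pi>'" using tendsto_diff[OF u z] by simp
  have p: "p \<longlonglongrightarrow> p'"
    using tendsto_scaleR[OF tendsto_const[of c] tendsto_matrix[OF \<pi>, of W]]
    unfolding p'_def p_eq[symmetric] .
  have MX: "(\<lambda>k. M *v X k) \<longlonglongrightarrow> z'" using tendsto_add[OF z F(2)] by (simp add: MX_eq)
  have "(\<lambda>k. M *v x k) \<longlonglongrightarrow> z'" using tendsto_add[OF MX \<delta>_lim] by (simp add: \<delta>_def)
  with that sol' z p MX show thesis by blast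
qed

section \<open>Primal optimality of the limits\<close>

text \<open>The exact value \<open>a k\<close> is bounded by the subgradient inequality at the fixed
  point \<open>y\<close>; the quadratic terms vanish because \<open>M *v X k\<close>,
  \<open>M *v x k\<close> and \<open>z k\<close> share a limit.\<close>

lemma f_upper_bounds:
  assumes z: "z \<longlonglongrightarrow> z'" and p: "p \<longlonglongrightarrow> p'" and MX: "(\<lambda>k. M *v X k) \<longlonglongrightarrow> z'"
    and Mx: "(\<lambda>k. M *v x k) \<longlonglongrightarrow> z'" and y: "f y = ereal s"
  obtains \<beta> where "\<beta> \<longlonglongrightarrow> s + p' \<bullet> (M *v y - z')" "\<And>k. f (x k) \<le> ereal (\<beta> k)"
proof -
  define \<beta> where "\<beta> k = (s - r k \<bullet> (M *v X k - M *v y)) + p k \<bullet> (M *v X k - M *v x k)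
        + c / 2 * (norm_W W (M *v X k - z k))\<^sup>2 - c / 2 * (norm_W W (M *v x k - z k))\<^sup>2 + \<tau> k" for k
  have zero: "(\<lambda>k. norm_W W (v k - z k)) \<longlonglongrightarrow> 0" if "v \<longlonglongrightarrow> z'" for v
    using tendsto_diff[OF that z] tendsto_norm_W_iff[OF W, of "\<lambda>k. v k - z k" 0] by simp
  have e0: "e \<longlonglongrightarrow> 0" using tendsto_diff[OF MX z] by (simp add: e_def[abs_def])
  have r: "r \<longlonglongrightarrow> p'"
    using tendsto_add[OF p tendsto_scaleR[OF tendsto_const[of c] tendsto_matrix[OF e0, of W]]]
    by (simp add: r_def[abs_def])
  have "\<beta> \<longlonglongrightarrow> (s - p' \<bullet> (z' - M *v y)) + p' \<bullet> (z' - z') + c / 2 * 0\<^sup>2 - c / 2 * 0\<^sup>2 + 0"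
    unfolding \<beta>_def by (intro tendsto_intros r p MX Mx \<tau> zero)
  then have "\<beta> \<longlonglongrightarrow> s + p' \<bullet> (M *v y - z')" by (simp add: inner_diff_right algebra_simps)
  moreover have "f (x k) \<le> ereal (\<beta> k)" for k
    by (rule order_trans[OF fx]) (use a_le[OF y, of k] in \<open>simp add: \<beta>_def\<close>)
  ultimately show thesis using that by blast
qed

text \<open>The linear term in the bound on \<open>f w\<close> is the one in the subgradient
  inequality of \<open>g\<close> at \<open>z'\<close>, so the two combine to optimality against
  every \<open>y\<close>.\<close>

lemma primal_minimizer:
  assumes sol: "splitting_solution f g M z' p'" and "M *v w = z'"
    and w: "\<And>y s. f y = ereal s \<Longrightarrow> f w \<le> ereal (s + p' \<bullet> (M *v y - z'))"
  shows "minimizer (primal_obj f g M) w"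
proof -
  obtain b' where b': "g z' = ereal b'" "\<And>v. ereal (b' + p' \<bullet> (v - z')) \<le> g v"
    using sol unfolding splitting_solution_def by blast
  have "primal_obj f g M w \<le> primal_obj f g M y" for y
  proof (cases "f y = \<infinity>")
    case False
    then obtain s where s: "f y = ereal s" using f_real by blast
    have "f w + g z' \<le> ereal (s + p' \<bullet> (M *v y - z')) + ereal b'"
      using w[OF s] b'(1) by (intro add_mono) auto
    also have "\<dots> = ereal s + ereal (b' + p' \<bullet> (M *v y - z'))" by simp
    also have "\<dots> \<le> f y + g (M *v y)" using s b'(2) by (intro add_mono) auto
    finally show ?thesis by (simp add: primal_obj_def assms(2))
  qed (simp add: primal_obj_def)
  then show ?thesis by (simp add: is_arg_min_linorder)
qed

context
  fixes z' p'
  assumes sol: "splitting_solution f g M z' p'" and z: "z \<longlonglongrightarrow> z'" and p: "p \<longlonglongrightarrow> p'"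
    and MX: "(\<lambda>k. M *v X k) \<longlonglongrightarrow> z'" and Mx: "(\<lambda>k. M *v x k) \<longlonglongrightarrow> z'"
begin

lemma primal_limit_point:
  assumes \<phi>: "strict_mono \<phi>" and w: "(\<lambda>k. x (\<phi> k)) \<longlonglongrightarrow> w"
  shows "minimizer (primal_obj f g M) w"
proof (rule primal_minimizer[OF sol])
  have "(\<lambda>k. M *v x (\<phi> k)) \<longlonglongrightarrow> z'"
    using LIMSEQ_subseq_LIMSEQ[OF Mx \<phi>] by (simp add: o_def)
  with tendsto_matrix[OF w, of M] show "M *v w = z'" by (rule LIMSEQ_unique)
  fix y s assume "f y = ereal s"
  then obtain \<beta> where \<beta>: "\<beta> \<longlonglongrightarrow> s + p' \<bullet> (M *v y - z')" "\<And>k. f (x k) \<le> ereal (\<beta> k)"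
    using f_upper_bounds[OF z p MX Mx] by blast
  have "(\<lambda>k. \<beta> (\<phi> k)) \<longlonglongrightarrow> s + p' \<bullet> (M *v y - z')"
    using LIMSEQ_subseq_LIMSEQ[OF \<beta>(1) \<phi>] by (simp add: o_def)
  with w show "f w \<le> ereal (s + p' \<bullet> (M *v y - z'))"
    by (rule closed_epigraph_limit[rotated]) (use f \<beta>(2) in \<open>auto simp: closed_proper_convex_def\<close>)
qed

text \<open>The point from \<open>image_limit_attained\<close> inherits every convergent upper bound
  on \<open>f (x k)\<close>. The bound obtained from \<open>X 0\<close> gives the uniform bound
  required there; those from arbitrary \<open>y\<close> give optimality.\<close>

lemma primal_attained:
  assumes "rel_interior (\<Union>y. subdifferential f y) \<inter> range (\<lambda>q. transpose M *v q) \<noteq> {}"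
  shows "\<exists>w. minimizer (primal_obj f g M) w \<and> z' = M *v w"
proof -
  obtain q where q: "transpose M *v q \<in> rel_interior (\<Union>y. subdifferential f y)"
    using assms by blast
  obtain \<beta> where \<beta>: "\<beta> \<longlonglongrightarrow> a 0 + p' \<bullet> (M *v X 0 - z')" "\<And>k. f (x k) \<le> ereal (\<beta> k)"
    using f_upper_bounds[OF z p MX Mx fX] by blast
  from convergent_imp_Bseq[OF convergentI[OF \<beta>(1)]] obtain A where "\<And>k. \<beta> k \<le> A"
    by (auto simp: Bseq_def dest: abs_le_D1)
  then have "f (x k) \<le> ereal A" for k
    using \<beta>(2)[of k] by (meson ereal_less_eq(3) order_trans)
  then obtain w where w: "M *v w = z'"
    "\<And>\<beta> b. \<beta> \<longlonglongrightarrow> b \<Longrightarrow> (\<And>k. f (x k) \<le> ereal (\<beta> k)) \<Longrightarrow> f w \<le> ereal b"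
    using image_limit_attained[OF f q Mx] by metis
  have "f w \<le> ereal (s + p' \<bullet> (M *v y - z'))" if y: "f y = ereal s" for y s
  proof -
    obtain \<beta> where "\<beta> \<longlonglongrightarrow> s + p' \<bullet> (M *v y - z')" "\<And>k. f (x k) \<le> ereal (\<beta> k)"
      using f_upper_bounds[OF z p MX Mx y] by blast
    then show ?thesis by (rule w(2))
  qed
  with primal_minimizer[OF sol w(1)] w(1) show ?thesis by blast
qed

end

text \<open>
  The weighted averages of the exact dual points \<open>P k\<close> approximately minimize the dual objective,
  because the gap telescopes by \<open>ergodic_bounds\<close>. No dual solution is needed for this.
\<close>

lemma bounded_imp_dual_minimizer:
  assumes bz: "bounded (range z)" and bp: "bounded (range p)"
  shows "\<exists>q. minimizer (dual_obj f g M) q"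
proof -
  have "bounded (range \<pi>)"
  proof -
    have "bounded ((\<lambda>q. scaled_dual q) ` range p)"
      unfolding scaled_dual_def
      by (intro bounded_linear_image[OF bp] bounded_linear_scaleR_right
          bounded_linear_compose[OF bounded_linear_scaleR_right] matrix_vector_mul_bounded_linear)
    then show ?thesis by (simp add: image_image \<pi>_def[abs_def])
  qed
  then obtain U1 U2 where U1: "\<And>k. norm_W W (z k) \<le> U1" and U2: "\<And>k. norm_W W (\<pi> k) \<le> U2"
    using bz bounded_norm_W_iff[OF W] by metis
  define U where "U = U1 + U2"
  have "0 \<le> U1" "0 \<le> U2"
    using order_trans[OF norm_W_nonneg[OF W] U1] order_trans[OF norm_W_nonneg[OF W] U2] by auto
  then have U: "norm_W W (z k) \<le> U" "norm_W W (\<pi> k) \<le> U" "norm_W W (z k + \<pi> k) \<le> U" for k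
    using U1[of k] U2[of k] norm_W_triangle[OF W, of "z k" "\<pi> k"] by (auto simp: U_def)
  obtain C where C:
    "\<And>N. - C \<le> (\<Sum>k<N. \<nu> k * (inner_W W (\<pi> k + e k) (z k + e k) - inner_W W (\<pi> k + \<epsilon> k) (z k - \<epsilon> k)))"
    "\<And>N. norm_W W (\<Sum>k<N. \<nu> k *\<^sub>R (e k + \<epsilon> k)) \<le> C"
    "\<And>N. norm_W W (\<Sum>k<N. \<nu> k *\<^sub>R (e k - \<epsilon> k)) \<le> C"
    by (rule ergodic_bounds[where U = U, OF W \<nu>(1) \<nu>(2) \<nu>(3) \<nu>(4)
      recursion \<epsilon>_summable \<delta>_summable U], rule that)
  define S where "S N = (\<Sum>k<N. \<nu> k)" for N
  define A where "A N = (1 / S N) *\<^sub>R (\<Sum>k<N. \<nu> k *\<^sub>R P k)" for N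
  have \<nu>_pos: "0 < \<nu> k" for k using \<nu>(1) \<nu>(2)[of k] by linarith
  have S_pos: "0 < S (Suc N)" for N unfolding S_def by (rule sum_pos) (auto simp: \<nu>_pos)
  have "filterlim S at_top sequentially"
  proof (rule filterlim_at_top_mono)
    show "filterlim (\<lambda>N. l * real N) at_top sequentially"
      using \<nu>(1) by (intro filterlim_tendsto_pos_mult_at_top[OF tendsto_const] filterlim_real_sequentially)
    show "eventually (\<lambda>N. l * real N \<le> S N) sequentially"
    proof (intro always_eventually allI)
      fix N show "l * real N \<le> S N"
        using sum_mono[of "{..<N}" "\<lambda>_. l" \<nu>] \<nu>(2) by (simp add: S_def mult.commute)
    qed
  qed
  then have S_inv: "(\<lambda>N. - K / S N) \<longlonglongrightarrow> 0" for K
    by (intro tendsto_divide_0[OF tendsto_const] filterlim_at_top_imp_at_infinity)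
  have "bounded (range A)"
  proof -
    have "bounded (range P)"
    proof -
      obtain Bp where Bp: "\<And>k. norm (p k) \<le> Bp" using bp by (auto simp: bounded_iff)
      have "(\<lambda>k. c *\<^sub>R (W *v \<epsilon> k)) \<longlonglongrightarrow> c *\<^sub>R (W *v 0)"
        by (intro tendsto_scaleR tendsto_const tendsto_matrix \<epsilon>_lim)
      from convergent_imp_Bseq[OF convergentI[OF this]]
      obtain Be where Be: "\<And>k. norm (c *\<^sub>R (W *v \<epsilon> k)) \<le> Be"
        by (auto simp: Bseq_def)
      have "norm (P k) \<le> Bp + Be" for k
        using norm_triangle_mono[OF Bp[of k] Be[of k]] by (simp add: P_def)
      then show ?thesis by (auto simp: bounded_iff)
    qed
    then obtain K where K: "\<And>k. norm (P k) \<le> K" by (auto simp: bounded_iff)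
    have "norm (A N) \<le> K" for N
    proof (cases N)
      case 0
      then show ?thesis using order_trans[OF norm_ge_zero K] by (simp add: A_def)
    next
      case (Suc n)
      then have SN: "0 < S N" using S_pos by simp
      have "norm (\<Sum>k<N. \<nu> k *\<^sub>R P k) \<le> (\<Sum>k<N. \<nu> k * K)"
        by (rule sum_norm_le) (use \<nu>_pos K in \<open>simp add: less_imp_le mult_left_mono\<close>)
      also have "\<dots> = K * S N" by (simp add: S_def sum_distrib_left mult.commute)
      finally show ?thesis using SN by (simp add: A_def pos_divide_le_eq)
    qed
    then show ?thesis by (auto simp: bounded_iff)
  qed
  then obtain q' \<phi> where \<phi>: "strict_mono \<phi>" "(A \<circ> \<phi>) \<longlonglongrightarrow> q'"
    using bounded_imp_convergent_subsequence by blast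
  \<comment> \<open>Optimality of \<open>q'\<close> in real terms, stated before its dual value is
    known to be finite: the infimum of the right-hand side over \<open>y\<close> and
    \<open>v\<close> is the dual value at \<open>q\<close> minus that at \<open>q'\<close>.\<close>
  have gap: "0 \<le> R1 + R2 + s + t + q' \<bullet> (M *v y - v)"
    if R: "conjugate f (- (transpose M *v q)) = ereal R1" "conjugate g q = ereal R2"
      and s: "f y = ereal s" and t: "g v = ereal t" for q y v R1 R2 s t
  proof -
    define T where "T k = inner_W W (\<pi> k + e k) (z k + e k) - inner_W W (\<pi> k + \<epsilon> k) (z k - \<epsilon> k)" for k
    define G where "G = R1 + R2 + s + t"
    \<comment> \<open>Sum of two Fenchel and two subgradient inequalities. The residuals are
      \<open>e k + \<epsilon> k = M *v X k - Z k\<close>, the pairing \<open>T k\<close> of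
      \<open>ergodic_bounds\<close>, and
      \<open>r k - P k = c *\<^sub>R (W *v (e k - \<epsilon> k))\<close>. Their weighted sums are
      bounded, so division by \<open>S N\<close> removes them in the limit.\<close>
    have "- (q \<bullet> (e k + \<epsilon> k)) + c * T k - c * inner_W W (e k - \<epsilon> k) (M *v y)
        \<le> G + P k \<bullet> (M *v y - v)" for k
    proof -
      have 1: "- (q \<bullet> (M *v X k)) - a k \<le> R1"
        using conjugate_transpose_ge[of f "X k" "a k" q M] fX R(1) by simp
      have 2: "q \<bullet> Z k - b k \<le> R2" using conjugate_ge[of g "Z k" "b k" q] gZ R(2) by simp
      have 3: "c * T k = r k \<bullet> (M *v X k) - P k \<bullet> Z k"
        unfolding T_def r_eq P_eq inner_scaled right_diff_distrib MX_eq[symmetric] Z_eq[symmetric] ..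
      have 4: "r k \<bullet> (M *v y) = P k \<bullet> (M *v y) + c * inner_W W (e k - \<epsilon> k) (M *v y)"
        unfolding r_eq P_eq inner_scaled by (simp add: inner_W_linear algebra_simps)
      have 5: "q \<bullet> (e k + \<epsilon> k) = q \<bullet> (M *v X k) - q \<bullet> Z k"
        by (simp add: e_def \<epsilon>_def inner_simps)
      show ?thesis
        using 1 2 4 a_le[OF s, of k] b_le[OF t, of k]
        unfolding 3 5 G_def inner_diff_right by linarith
    qed
    then have "(\<Sum>k<N. \<nu> k * (- (q \<bullet> (e k + \<epsilon> k)) + c * T k - c * inner_W W (e k - \<epsilon> k) (M *v y)))
        \<le> (\<Sum>k<N. \<nu> k * (G + P k \<bullet> (M *v y - v)))" for N
      by (intro sum_mono mult_left_mono) (auto simp: \<nu>_pos less_imp_le)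
    moreover have "(\<Sum>k<N. \<nu> k * (G + P k \<bullet> (M *v y - v)))
        = S N * G + (\<Sum>k<N. \<nu> k *\<^sub>R P k) \<bullet> (M *v y - v)" for N
      by (simp add: S_def distrib_left sum.distrib sum_distrib_right inner_sum_left)
    moreover have "(\<Sum>k<N. \<nu> k * (- (q \<bullet> (e k + \<epsilon> k)) + c * T k - c * inner_W W (e k - \<epsilon> k) (M *v y)))
        = - (q \<bullet> (\<Sum>k<N. \<nu> k *\<^sub>R (e k + \<epsilon> k))) + c * (\<Sum>k<N. \<nu> k * T k)
          - c * inner_W W (\<Sum>k<N. \<nu> k *\<^sub>R (e k - \<epsilon> k)) (M *v y)" for N
      by (induction N) (auto simp: inner_W_linear inner_simps algebra_simps inner_W_def)
    moreover define K where "K = c * (norm_W W (scaled_dual q) * C) + c * C + c * (C * norm_W W (M *v y))"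
    have "- K \<le> - (q \<bullet> (\<Sum>k<N. \<nu> k *\<^sub>R (e k + \<epsilon> k))) + c * (\<Sum>k<N. \<nu> k * T k)
          - c * inner_W W (\<Sum>k<N. \<nu> k *\<^sub>R (e k - \<epsilon> k)) (M *v y)" for N
    proof -
      let ?E = "\<Sum>k<N. \<nu> k *\<^sub>R (e k + \<epsilon> k)" and ?F = "\<Sum>k<N. \<nu> k *\<^sub>R (e k - \<epsilon> k)"
      have "q \<bullet> ?E = c * inner_W W (scaled_dual q) ?E"
        using inner_scaled[of "scaled_dual q" ?E] by (simp add: scaled_dual)
      also have "\<dots> \<le> c * (norm_W W (scaled_dual q) * C)"
        using c inner_W_le_norm_W[OF W, of "scaled_dual q" ?E]
          mult_left_mono[OF C(2)[of N] norm_W_nonneg[OF W, of "scaled_dual q"]]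
        by (intro mult_left_mono) auto
      finally have 1: "q \<bullet> ?E \<le> c * (norm_W W (scaled_dual q) * C)" .
      have 2: "c * inner_W W ?F (M *v y) \<le> c * (C * norm_W W (M *v y))"
        using c inner_W_le_norm_W[OF W, of ?F "M *v y"]
          mult_right_mono[OF C(3)[of N] norm_W_nonneg[OF W, of "M *v y"]]
        by (intro mult_left_mono) auto
      have 3: "- (c * C) \<le> c * (\<Sum>k<N. \<nu> k * T k)"
        using mult_left_mono[OF C(1)[of N], of c] c by (simp add: T_def)
      show ?thesis using 1 2 3 unfolding K_def by linarith
    qed
    ultimately have main: "- K \<le> S N * G + (\<Sum>k<N. \<nu> k *\<^sub>R P k) \<bullet> (M *v y - v)" for N
      by (fastforce intro: order_trans)
    have "- K / S N \<le> G + A N \<bullet> (M *v y - v)" if "0 < S N" for N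
    proof -
      have "S N * (G + A N \<bullet> (M *v y - v)) = S N * G + (\<Sum>k<N. \<nu> k *\<^sub>R P k) \<bullet> (M *v y - v)"
        using that by (simp add: A_def distrib_left)
      with main[of N] have "- K \<le> (G + A N \<bullet> (M *v y - v)) * S N" by (simp add: mult.commute)
      with that show ?thesis by (rule pos_divide_le_eq[THEN iffD2])
    qed
    then have "eventually (\<lambda>N. - K / S (\<phi> N) \<le> G + A (\<phi> N) \<bullet> (M *v y - v)) sequentially"
    \<comment> \<open>Index \<open>0\<close> is skipped because the division needs a positive weight
      and \<open>S 0\<close> is an empty sum.\<close>
    proof (intro eventually_sequentiallyI[of 1])
      fix N :: nat assume "1 \<le> N"
      then have "0 < \<phi> N" using seq_suble[OF \<phi>(1), of N] by linarith
      then obtain n where "\<phi> N = Suc n" by (cases "\<phi> N") auto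
      then show "- K / S (\<phi> N) \<le> G + A (\<phi> N) \<bullet> (M *v y - v)"
        using \<open>\<And>N. 0 < S N \<Longrightarrow> - K / S N \<le> G + A N \<bullet> (M *v y - v)\<close> S_pos[of n] by metis
    qed
    moreover have "(\<lambda>N. - K / S (\<phi> N)) \<longlonglongrightarrow> 0"
      using LIMSEQ_subseq_LIMSEQ[OF S_inv \<phi>(1), of K] by (simp add: o_def)
    moreover have "(\<lambda>N. G + A (\<phi> N) \<bullet> (M *v y - v)) \<longlonglongrightarrow> G + q' \<bullet> (M *v y - v)"
      using \<phi>(2) by (intro tendsto_intros) (simp add: o_def)
    ultimately have "0 \<le> G + q' \<bullet> (M *v y - v)"
      by (intro tendsto_le[of sequentially]) auto
    then show ?thesis by (simp add: G_def)
  qed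
  have f_ninf: "conjugate f q \<noteq> - \<infinity>" and g_ninf: "conjugate g q2 \<noteq> - \<infinity>" for q q2
    using f g by (auto intro!: conjugate_proper_not_MInf simp: closed_proper_convex_def
        dest: conjugate_proper_not_MInf)
  have "dual_obj f g M q' \<le> dual_obj f g M q" for q
  proof (cases "conjugate f (- (transpose M *v q)) = \<infinity> \<or> conjugate g q = \<infinity>")
    case True
    then show ?thesis using f_ninf g_ninf by (auto simp: dual_obj_def)
  next
    case False
    then obtain R1 R2 where R: "conjugate f (- (transpose M *v q)) = ereal R1" "conjugate g q = ereal R2"
      using f_ninf g_ninf by (metis ereal_cases)
    \<comment> \<open>The infimum over \<open>y\<close> comes first: with \<open>v = Z 0\<close> it
      shows that the conjugate of \<open>f\<close> is real, and only then can the infimum over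
      \<open>v\<close> be rearranged.\<close>
    have f_le: "conjugate f (- (transpose M *v q')) \<le> ereal (- (q' \<bullet> v - R1 - R2 - t))"
      if t: "g v = ereal t" for v t
    proof (rule conjugate_transpose_le)
      fix y show "ereal (q' \<bullet> v - R1 - R2 - t - q' \<bullet> (M *v y)) \<le> f y"
      proof (cases "f y = \<infinity>")
        case False
        then obtain s where "f y = ereal s" using f_real by blast
        with gap[OF R _ t] show ?thesis by (fastforce simp: inner_diff_right)
      qed simp
    qed
    then obtain R1' where R1': "conjugate f (- (transpose M *v q')) = ereal R1'"
      using gZ[of 0] f_ninf by (cases "conjugate f (- (transpose M *v q'))") fastforce+
    have "conjugate g q' \<le> ereal (R1 + R2 - R1')"
    proof (rule conjugate_le)
      fix v show "ereal (q' \<bullet> v - (R1 + R2 - R1')) \<le> g v"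
      proof (cases "g v = \<infinity>")
        case False
        then obtain t where "g v = ereal t" using g_real by blast
        with f_le[of v t] show ?thesis by (simp add: R1')
      qed simp
    qed
    then have "ereal R1' + conjugate g q' \<le> ereal R1' + ereal (R1 + R2 - R1')"
      by (intro add_mono) auto
    then show ?thesis by (simp add: dual_obj_def R R1')
  qed
  then show ?thesis by (auto simp: is_arg_min_linorder)
qed

end

section \<open>Application to the given iterates\<close>

text \<open>Quadratic growth yields distances of order \<open>sqrt (\<tau> k)\<close> only, hence
  the summability of square roots.\<close>

lemma summable_norm_W_of_sqrt:
  assumes W: "symmetric_positive_definite W" and c: "c > 0" and "summable (\<lambda>k. sqrt (\<tau> k))"
    and le: "\<And>k. c / 2 * (norm_W W (v k))\<^sup>2 \<le> \<tau> k"
  shows "summable (\<lambda>k. norm_W W (v k))"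
proof (rule summable_comparison_test')
  show "summable (\<lambda>k. sqrt (2 / c) * sqrt (\<tau> k))" by (intro summable_mult assms)
  fix k
  have "(norm_W W (v k))\<^sup>2 \<le> 2 / c * \<tau> k" using le[of k] c by (simp add: field_simps)
  then have "norm_W W (v k) \<le> sqrt (2 / c * \<tau> k)" by (rule real_le_rsqrt)
  then show "norm (norm_W W (v k)) \<le> sqrt (2 / c) * sqrt (\<tau> k)"
    by (simp add: norm_W_nonneg[OF W] real_sqrt_mult[symmetric])
qed

theorem proposition17:
  fixes f :: "real^'n \<Rightarrow> ereal"
    and g :: "real^'m \<Rightarrow> ereal"
    and M :: "real^'n^'m"
    and W :: "real^'m^'m"
    and \<tau>x \<tau>z \<nu> :: "nat \<Rightarrow> real"
    and c :: real
    and x :: "nat \<Rightarrow> real^'n"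
    and z p :: "nat \<Rightarrow> real^'m"
  assumes f: "closed_proper_convex f"
    and g: "closed_proper_convex g"
    and W: "symmetric_positive_definite W"
    and \<tau>x_nonneg: "\<And>k. \<tau>x k \<ge> 0"
    and \<tau>z_nonneg: "\<And>k. \<tau>z k \<ge> 0"
    and \<tau>x_summable: "summable (\<lambda>k. sqrt (\<tau>x k))"
    and \<tau>z_summable: "summable (\<lambda>k. sqrt (\<tau>z k))"
    and \<nu>_inf: "(INF k. ereal (\<nu> k)) > 0"
    and \<nu>_sup: "(SUP k. ereal (\<nu> k)) < 2"
    and c: "c > 0"
    and x_step: "\<And>k. x (Suc k) \<in> approx_argmin (\<tau>x k) UNIV (x_obj f M W c (p k) (z k))"
    and z_step: "\<And>k. z (Suc k) \<in> approx_argmin (\<tau>z k) UNIV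
      (z_obj g W c (p k) (\<nu> k *\<^sub>R (M *v x (Suc k)) + (1 - \<nu> k) *\<^sub>R z k))"
    and p_step: "\<And>k. p (Suc k) =
      p k + c *\<^sub>R (W *v (\<nu> k *\<^sub>R (M *v x (Suc k)) + (1 - \<nu> k) *\<^sub>R z k - z (Suc k)))"
    and x_attained: "\<And>k. \<exists>x'. minimizer (x_obj f M W c (p k) (z k)) x'"
    and z_attained: "\<And>k. \<exists>z'. minimizer
      (z_obj g W c (p k) (\<nu> k *\<^sub>R (M *v x (Suc k)) + (1 - \<nu> k) *\<^sub>R z k)) z'"
  shows "(strong_duality f g M \<longrightarrow>
      (\<exists>p_star z_star.
        minimizer (dual_obj f g M) p_star
        \<and> p \<longlonglongrightarrow> p_star
        \<and> z \<longlonglongrightarrow> z_star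
        \<and> (\<lambda>k. M *v x (Suc k)) \<longlonglongrightarrow> z_star
        \<and> z_star \<in> subdifferential (conjugate g) p_star
        \<and> - z_star \<in> subdifferential (\<lambda>q. conjugate f (- (transpose M *v q))) p_star
        \<and> (rel_interior (\<Union>y. subdifferential f y) \<inter> range (\<lambda>q. transpose M *v q) \<noteq> {} \<longrightarrow>
            (\<exists>x_star. minimizer (primal_obj f g M) x_star \<and> z_star = M *v x_star)
            \<and> (\<forall>l. limit_point (\<lambda>k. x (Suc k)) l \<longrightarrow> minimizer (primal_obj f g M) l))))
    \<and> ((\<nexists>p_star. minimizer (dual_obj f g M) p_star)
        \<and> (\<exists>p_bar. \<bar>dual_obj f g M p_bar\<bar> \<noteq> \<infinity>) \<longrightarrow>
      \<not> bounded (range p) \<or> \<not> bounded (range z))"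
proof -
  define w where "w k = \<nu> k *\<^sub>R (M *v x (Suc k)) + (1 - \<nu> k) *\<^sub>R z k" for k
  have p_w: "p (Suc k) = p k + c *\<^sub>R (W *v (w k - z (Suc k)))" for k
    unfolding w_def by (rule p_step)
  obtain l where l: "0 < ereal l" "ereal l < (INF k. ereal (\<nu> k))"
    using ereal_dense2[OF \<nu>_inf] by blast
  obtain h where h: "(SUP k. ereal (\<nu> k)) < ereal h" "ereal h < 2"
    using ereal_dense2[OF \<nu>_sup] by blast
  have l_le: "l \<le> \<nu> k" for k
    using order.trans[OF less_imp_le[OF l(2)] INF_lower[of k UNIV]] by simp
  have le_h: "\<nu> k \<le> h" for k
    using order.trans[OF SUP_upper[of k UNIV] less_imp_le[OF h(1)]] by simp
  have "\<exists>u a. f u = ereal a \<and>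
      (\<forall>y. ereal (a + (p k + c *\<^sub>R (W *v (M *v u - z k))) \<bullet> (M *v u - M *v y)) \<le> f y) \<and>
      c / 2 * (norm_W W (M *v x (Suc k) - M *v u))\<^sup>2 \<le> \<tau>x k \<and>
      f (x (Suc k)) \<le> ereal (a + p k \<bullet> (M *v u - M *v x (Suc k))
        + c / 2 * (norm_W W (M *v u - z k))\<^sup>2 - c / 2 * (norm_W W (M *v x (Suc k) - z k))\<^sup>2 + \<tau>x k)" for k
    by (rule approx_step[OF f W x_step[of k] x_attained[of k]]) blast
  then obtain X a where X: "\<And>k. f (X k) = ereal (a k)"
    "\<And>k y. ereal (a k + (p k + c *\<^sub>R (W *v (M *v X k - z k))) \<bullet> (M *v X k - M *v y)) \<le> f y"
    "\<And>k. c / 2 * (norm_W W (M *v x (Suc k) - M *v X k))\<^sup>2 \<le> \<tau>x k"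
    "\<And>k. f (x (Suc k)) \<le> ereal (a k + p k \<bullet> (M *v X k - M *v x (Suc k))
        + c / 2 * (norm_W W (M *v X k - z k))\<^sup>2 - c / 2 * (norm_W W (M *v x (Suc k) - z k))\<^sup>2 + \<tau>x k)"
    by metis
  have "\<exists>u b. g u = ereal b \<and>
      (\<forall>v. ereal (b + (p (Suc k) + c *\<^sub>R (W *v (z (Suc k) - u))) \<bullet> (v - u)) \<le> g v) \<and>
      c / 2 * (norm_W W (z (Suc k) - u))\<^sup>2 \<le> \<tau>z k" for k
  proof -
    have zs: "z (Suc k) \<in> approx_argmin (\<tau>z k) UNIV (x_obj g (mat 1) W c (- p k) (w k))"
      "\<exists>z'. minimizer (x_obj g (mat 1) W c (- p k) (w k)) z'"
      using z_step[of k] z_attained[of k] by (simp_all add: z_obj_eq_x_obj[OF W] w_def)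
    obtain u b where u: "g u = ereal b"
      "\<And>v. ereal (b + (- p k + c *\<^sub>R (W *v (u - w k))) \<bullet> (u - v)) \<le> g v"
      "c / 2 * (norm_W W (z (Suc k) - u))\<^sup>2 \<le> \<tau>z k"
      by (rule approx_step[OF g W zs]) auto
    \<comment> \<open>The update of \<open>p\<close> rewrites the multiplier
      \<open>p k + c *\<^sub>R (W *v (w k - u))\<close> of the exact \<open>z\<close>-step in terms
      of the new iterates.\<close>
    have eq: "(p (Suc k) + c *\<^sub>R (W *v (z (Suc k) - u))) \<bullet> (v - u)
        = (- p k + c *\<^sub>R (W *v (u - w k))) \<bullet> (u - v)" for v
      by (simp add: p_w matrix_vector_mult_diff_distrib inner_simps
          algebra_simps)
    show ?thesis using u(1) u(2)[folded eq] u(3) by blast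
  qed
  then obtain Z b where Z: "\<And>k. g (Z k) = ereal (b k)"
    "\<And>k v. ereal (b k + (p (Suc k) + c *\<^sub>R (W *v (z (Suc k) - Z k))) \<bullet> (v - Z k)) \<le> g v"
    "\<And>k. c / 2 * (norm_W W (z (Suc k) - Z k))\<^sup>2 \<le> \<tau>z k"
    by metis
  have \<tau>_lim: "\<tau>x \<longlonglongrightarrow> 0"
    using tendsto_power[OF summable_LIMSEQ_zero[OF \<tau>x_summable], of 2] by (simp add: \<tau>x_nonneg)
  \<comment> \<open>Shifted by one: \<open>z 0\<close> and \<open>p 0\<close> are arbitrary, whereas
    \<open>Z k\<close> certifies the pair \<open>z (Suc k)\<close>, \<open>p (Suc k)\<close>. The
    \<open>x\<close>-step started from this pair produces \<open>x (Suc (Suc k))\<close>.\<close>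
  interpret A: inexact_admm f g M W c l h "\<lambda>k. \<nu> (Suc k)" "\<lambda>k. \<tau>x (Suc k)" "\<lambda>k. a (Suc k)" b
    "\<lambda>k. z (Suc k)" "\<lambda>k. p (Suc k)" Z "\<lambda>k. x (Suc (Suc k))" "\<lambda>k. X (Suc k)"
  proof
    show "0 < l" using l(1) by simp
    show "h < 2" using h(2) by simp
    show "summable (\<lambda>k. norm_W W (M *v x (Suc (Suc k)) - M *v X (Suc k)))"
      using summable_norm_W_of_sqrt[OF W c \<tau>x_summable X(3)]
      by (rule summable_Suc_iff[THEN iffD2])
    show "summable (\<lambda>k. norm_W W (z (Suc k) - Z k))"
      using summable_norm_W_of_sqrt[OF W c \<tau>z_summable Z(3)] .
    show "(\<lambda>k. \<tau>x (Suc k)) \<longlonglongrightarrow> 0" using \<tau>_lim by (rule LIMSEQ_Suc)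
    show "p (Suc (Suc k)) + c *\<^sub>R (W *v z (Suc (Suc k))) = p (Suc k) + c *\<^sub>R
        (W *v (\<nu> (Suc k) *\<^sub>R (M *v x (Suc (Suc k))) + (1 - \<nu> (Suc k)) *\<^sub>R z (Suc k)))" for k
      unfolding p_w[of "Suc k"] w_def[symmetric]
      by (simp add: matrix_vector_mult_diff_distrib algebra_simps)
  qed (use f g W c l_le le_h X Z in auto)
  show ?thesis (is "(_ \<longrightarrow> ?conv) \<and> (_ \<longrightarrow> ?unb)")
  proof (intro conjI impI)
    assume "strong_duality f g M"
    then obtain z0 p0 where "splitting_solution f g M z0 p0"
      using strong_duality_imp_solution f g unfolding closed_proper_convex_def by blast
    then obtain z' p' where lims: "splitting_solution f g M z' p'" "(\<lambda>k. z (Suc k)) \<longlonglongrightarrow> z'"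
      "(\<lambda>k. p (Suc k)) \<longlonglongrightarrow> p'" "(\<lambda>k. M *v X (Suc k)) \<longlonglongrightarrow> z'"
      "(\<lambda>k. M *v x (Suc (Suc k))) \<longlonglongrightarrow> z'"
      by (rule A.convergence)
    have limit: "minimizer (primal_obj f g M) y" if lp: "limit_point (\<lambda>k. x (Suc k)) y" for y
    proof -
      obtain r where r: "strict_mono r" "(\<lambda>k. x (Suc (r k))) \<longlonglongrightarrow> y"
        using lp by (auto simp: limit_point_def o_def)
      \<comment> \<open>The shifted sequence begins with \<open>x (Suc (Suc 0))\<close>, so the
        subsequence drops its first entry; then \<open>r (Suc k)\<close> is positive and the
        natural-number subtraction is exact.\<close>
      have Suc_r: "Suc (r (Suc k) - 1) = r (Suc k)" for k
        using seq_suble[OF r(1), of "Suc k"] by simp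
      have "strict_mono (\<lambda>k. r (Suc k) - 1)"
        unfolding strict_mono_Suc_iff using r(1) Suc_r
        by (metis Suc_less_eq strict_mono_Suc_iff)
      moreover have "(\<lambda>k. x (Suc (Suc (r (Suc k) - 1)))) \<longlonglongrightarrow> y"
        unfolding Suc_r by (rule LIMSEQ_Suc[OF r(2)])
      ultimately show ?thesis by (rule A.primal_limit_point[OF lims])
    qed
    show ?conv
    proof (rule exI[of _ p'], rule exI[of _ z'], intro conjI impI)
      show "minimizer (dual_obj f g M) p'" "z' \<in> subdifferential (conjugate g) p'"
        "- z' \<in> subdifferential (\<lambda>q. conjugate f (- (transpose M *v q))) p'"
        using splitting_solution_dual[OF lims(1)] by auto
      show "p \<longlonglongrightarrow> p'" using lims(3) by (rule LIMSEQ_imp_Suc)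
      show "z \<longlonglongrightarrow> z'" using lims(2) by (rule LIMSEQ_imp_Suc)
      show "(\<lambda>k. M *v x (Suc k)) \<longlonglongrightarrow> z'"
        using LIMSEQ_imp_Suc[of "\<lambda>k. M *v x (Suc k)"] lims(5) by blast
      show "\<forall>y. limit_point (\<lambda>k. x (Suc k)) y \<longrightarrow> minimizer (primal_obj f g M) y"
        using limit by blast
    next
      assume "rel_interior (\<Union>y. subdifferential f y) \<inter> range (\<lambda>q. transpose M *v q) \<noteq> {}"
      then show "\<exists>x_star. minimizer (primal_obj f g M) x_star \<and> z' = M *v x_star"
        by (rule A.primal_attained[OF lims])
    qed
  next
    assume no: "(\<nexists>p_star. minimizer (dual_obj f g M) p_star)
        \<and> (\<exists>p_bar. \<bar>dual_obj f g M p_bar\<bar> \<noteq> \<infinity>)"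
    show ?unb
    proof (rule ccontr)
      assume "\<not> ?unb"
      then have "bounded (range (\<lambda>k. z (Suc k)))" "bounded (range (\<lambda>k. p (Suc k)))"
        by (auto elim: bounded_subset)
      then show False using A.bounded_imp_dual_minimizer no by blast
    qed
  qed
qed

end
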